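(* Let $d\ge2$, let $G_4$ be the analytic continuation to $\mathcal{D}$ of the Euclidean four-point function of identical scalar operators of dimension $\Delta$ of a unitary CFT, and let $C_L\in\mathcal{D}_L$ be a Lorentzian configuration. If neither $z$ nor $\bar z$ computed from $C_L$ belongs to $(1,+\infty)$, then the Lorentzian four-point function $G_4$ is analytic at $C_L$ and is given there by $$G_4(C_L)=\frac{g(\chi,\bar\chi)}{[x_{12}^2x_{34}^2]^\Delta},$$ where $\chi=\chi(C_L,\gamma)$, $\bar\chi=\bar\chi(C_L,\gamma)$ are obtained from any admissible path $\gamma$ ending at $C_L$, and $g(\chi,\bar\chi)$ is computed by the convergent series $\sum_{h,\bar h\ge0} b_{h,\bar h}e^{ih\chi+i\bar h\bar\chi}$.
   Context: Kinematics. Points are $x_k=(\tau_k,\mathbf{x}_k)$, $\tau_k\in\mathbb{C}$, $\mathbf{x}_k\in\mathbb{R}^{d-1}$; $x_{ij}^2=(\tau_i-\tau_j)^2+(\mathbf{x}_i-\mathbf{x}_j)^2$. $\mathcal{D}$ is the set of four-point configurations with $\mathrm{Re}\,\tau_1>\mathrm{Re}\,\tau_2>\mathrm{Re}\,\tau_3>\mathrm{Re}\,\tau_4$; $\mathcal{D}_E\subset\mathcal{D}$ is the subset with all $\tau_k$ real; $\mathcal{D}_L$ is the set of Lorentzian configurations $x_k=(it_k,\mathbf{x}_k)$ ($t_k$ real) with $x_{ij}^2\ne0$ for all $i\neq j$; $\mathcal{D}_L$ lies in the boundary of $\mathcal{D}$. Cross-ratios: $u=\frac{x_{12}^2x_{34}^2}{x_{13}^2x_{24}^2}$,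 $v=\frac{x_{14}^2x_{23}^2}{x_{13}^2x_{24}^2}$; $z,\bar z$ are the two solutions (unordered) of $u=z\bar z$, $v=(1-z)(1-\bar z)$. $\Gamma=\{C\in\mathcal{D}: 4u-(1+u-v)^2=0\}$, i.e. the set where $z=\bar z$. $\rho(z)=\frac{(1-\sqrt{1-z})^2}{z}$ maps $\mathbb{C}\setminus[1,\infty)$ bijectively to the open unit disc; $\rho=\rho(z)$, $\bar\rho=\rho(\bar z)$. Known fact (to be used as given): $z,\bar z\notin\{0\}\cup[1,\infty)$ on $\mathcal{D}$. Admissible paths. An admissible path to $C$ is a continuous $\gamma:[0,1]\to\overline{\mathcal{D}}$ with $\gamma(0)\in\mathcal{D}_E\setminus\Gamma$, $\gamma(s)\in\mathcal{D}\setminus\Gamma$ for $s<1$, $\gamma(1)=C$. At $\gamma(0)$, $\bar z=z^*$ is non-real; label so that $\mathrm{Im}\,z>0$, and continue $z,\bar z$ continuously along $\gamma$. Define continuous $\chi,\bar\chi$ along $\gamma$ by $\rho=e^{i\chi}$, $\bar\rho=e^{i\bar\chi}$ and $0\le\mathrm{Re}\,\chi\le\pi$, $-\pi\le\mathrm{Re}\,\bar\chi\le0$ at $s=0$. $\chi(C,\gamma),\bar\chi(C,\gamma)$ are the values at $s=1$ (by continuity). Standing properties of the Euclidean four-point function. $G_4^E$ is a permutation-invariant function of four pairwise distinct points of $\mathbb{R}^d$ of the form $\frac{g(u,v)}{(x_{12}^2)^{\Delta}(x_{34}^2)^{\Delta}}$; for Euclidean configurations with $z\notin[1,\infty)$ (there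 $\bar\rho=\rho^*$), $g=\sum_{\delta\ge0}\sum_{l\in\mathbb{N}}c_{\delta,l}(\rho\bar\rho)^{\delta/2}P^l(\rho,\bar\rho)$, with $c_{\delta,l}\ge0$ and $P^l(\rho,\bar\rho)=\sum_{k=0}^lp^l_k(\rho/\bar\rho)^{l/2-k}$, $p^l_k=p^l_{l-k}$ (the Gegenbauer polynomial $C_l^{d/2-1}(\cos\theta)$ for $\rho=re^{i\theta},\bar\rho=re^{-i\theta}$). Equivalently $g=\sum_{h,\bar h\ge0}b_{h,\bar h}\rho^h\bar\rho^{\bar h}$ with $b_{h,\bar h}\ge0$, $h-\bar h\in\mathbb{Z}$, absolutely convergent for $0<|\rho|,|\bar\rho|<1$. One sets $g(\chi,\bar\chi)=\sum b_{h,\bar h}e^{ih\chi+i\bar h\bar\chi}$ on $\mathrm{Im}\,\chi,\mathrm{Im}\,\bar\chi>0$. It is known that $G_4^E$ extends to a function $G_4$ on $\mathcal{D}$, analytic in the $\tau_k$ and continuous in the $\mathbf{x}_k$, equal to $g(\chi(C,\gamma),\bar\chi(C,\gamma))/[x_{12}^2x_{34}^2]^{\Delta}$ for any admissible path $\gamma$. Powers of $x_{ij}^2$ denote the branch analytic on $\mathcal{D}$ that is positive on $\mathcal{D}_E$, extended to $\mathcal{D}_L$ by limits from $\mathcal{D}$. "$G_4$ is analytic at $C_L$" means: $G_4$ extends from $\mathcal{D}$ to a neighbourhood of $C_L$ (complex $\tau_k$, real $\mathbf{x}_k$) as a function analytic in the $\tau_k$ and continuous in the $\mathbf{x}_k$;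 its value at $C_L$ is $\lim_{\epsilon_k\to0,\ \epsilon_1>\epsilon_2>\epsilon_3>\epsilon_4}G_4(\epsilon_k+it_k,\mathbf{x}_k)$. *)

theory Defs
  imports "HOL-Analysis.Analysis"
begin

section \<open>Kinematics\<close>

text \<open>Space-time is \<^term>\<open>d = CARD('n) + 1\<close> dimensional, so \<^term>\<open>d \<ge> 2\<close> is automatic.  A
  configuration is a pair (tau, X) of four complex times and four spatial points.  In the index
  type \<^typ>\<open>4\<close> the numerals 1, 2, 3, 4 are distinct (4 is also called 0); its built-in order is
  never used below.\<close>

type_synonym 'n conf = "(complex ^ 4) \<times> ((real ^ 'n) ^ 4)"

definition xsq :: "4 \<Rightarrow> 4 \<Rightarrow> 'n::finite conf \<Rightarrow> complex" where
  "xsq i j C = (fst C $ i - fst C $ j)\<^sup>2 + of_real ((norm (snd C $ i - snd C $ j))\<^sup>2)"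

definition dom_D :: "'n::finite conf set" where
  "dom_D = {C. Re (fst C $ 1) > Re (fst C $ 2) \<and> Re (fst C $ 2) > Re (fst C $ 3)
              \<and> Re (fst C $ 3) > Re (fst C $ 4)}"

definition dom_DE :: "'n::finite conf set" where
  "dom_DE = {C \<in> dom_D. \<forall>k. Im (fst C $ k) = 0}"

definition dom_DL :: "'n::finite conf set" where
  "dom_DL = {C. (\<forall>k. Re (fst C $ k) = 0) \<and> (\<forall>i j. i \<noteq> j \<longrightarrow> xsq i j C \<noteq> 0)}"

text \<open>Four pairwise distinct points of Euclidean space, without any time ordering.\<close>

definition euclidean_confs :: "'n::finite conf set" where
  "euclidean_confs = {C. (\<forall>k. Im (fst C $ k) = 0) \<and>
     (\<forall>i j. i \<noteq> j \<longrightarrow> (fst C $ i, snd C $ i) \<noteq> (fst C $ j, snd C $ j))}"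

definition permute_conf :: "(4 \<Rightarrow> 4) \<Rightarrow> 'n::finite conf \<Rightarrow> 'n conf" where
  "permute_conf \<pi> C = ((\<chi> k. fst C $ \<pi> k), (\<chi> k. snd C $ \<pi> k))"

definition cr_u :: "'n::finite conf \<Rightarrow> complex" where
  "cr_u C = (xsq 1 2 C * xsq 3 4 C) / (xsq 1 3 C * xsq 2 4 C)"

definition cr_v :: "'n::finite conf \<Rightarrow> complex" where
  "cr_v C = (xsq 1 4 C * xsq 2 3 C) / (xsq 1 3 C * xsq 2 4 C)"

text \<open>\<^term>\<open>z\<close>, \<^term>\<open>zb\<close> are the two solutions, in some order.\<close>

definition is_z_pair :: "'n::finite conf \<Rightarrow> complex \<Rightarrow> complex \<Rightarrow> bool" where
  "is_z_pair C z zb \<longleftrightarrow> cr_u C = z * zb \<and> cr_v C = (1 - z) * (1 - zb)"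

definition Gamma_set :: "'n::finite conf set" where
  "Gamma_set = {C \<in> dom_D. 4 * cr_u C - (1 + cr_u C - cr_v C)\<^sup>2 = 0}"

definition rho :: "complex \<Rightarrow> complex" where
  "rho z = (1 - csqrt (1 - z))\<^sup>2 / z"


section \<open>Powers of the squared distances\<close>

text \<open>On \<^term>\<open>dom_D\<close> the squared distances avoid the closed negative half-axis, so the principal
  power is the branch that is analytic there and positive on \<^term>\<open>dom_DE\<close>.\<close>

lemma xsq_commute: "xsq i j C = xsq j i C"
  by (simp add: xsq_def norm_minus_commute power2_commute)

lemma xsq_notin_nonpos_Reals:
  assumes "Re (fst C $ i) \<noteq> Re (fst C $ j)"
  shows "xsq i j C \<notin> \<real>\<^sub>\<le>\<^sub>0"
proof
  let ?w = "fst C $ i - fst C $ j"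
  assume A: "xsq i j C \<in> \<real>\<^sub>\<le>\<^sub>0"
  have re: "Re (xsq i j C) = (Re ?w)\<^sup>2 - (Im ?w)\<^sup>2 + (norm (snd C $ i - snd C $ j))\<^sup>2"
    and im: "Im (xsq i j C) = 2 * Re ?w * Im ?w"
    by (simp_all only: xsq_def plus_complex.simps Re_power2 Im_power2 Re_complex_of_real
        Im_complex_of_real add_0_right)
  have w: "Re ?w \<noteq> 0" using assms by simp
  have "Im ?w = 0" using A im w by (simp add: complex_nonpos_Reals_iff)
  then have "Re (xsq i j C) > 0"
    using re w by (simp add: add_pos_nonneg)
  then show False using A by (simp add: complex_nonpos_Reals_iff)
qed

text \<open>Outside \<^term>\<open>dom_D\<close> the power is the limit from \<^term>\<open>dom_D\<close>, which exists at all
  points of \<^term>\<open>dom_DL\<close>; there it depends on the time ordering when \<^term>\<open>xsq i j C\<close> is negative.\<close>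

definition xsq_pow :: "real \<Rightarrow> 4 \<Rightarrow> 4 \<Rightarrow> 'n::finite conf \<Rightarrow> complex" where
  "xsq_pow \<Delta> i j C =
     (if C \<in> dom_D then xsq i j C powr of_real \<Delta>
      else Lim (at C within dom_D) (\<lambda>C'. xsq i j C' powr of_real \<Delta>))"

definition prefactor :: "real \<Rightarrow> 'n::finite conf \<Rightarrow> complex" where
  "prefactor \<Delta> C = xsq_pow \<Delta> 1 2 C * xsq_pow \<Delta> 3 4 C"


section \<open>Admissible paths and the variables chi, chi-bar\<close>

definition admissible :: "(real \<Rightarrow> 'n::finite conf) \<Rightarrow> 'n conf \<Rightarrow> bool" where
  "admissible \<gamma> C \<longleftrightarrow>
     path \<gamma> \<and> path_image \<gamma> \<subseteq> closure dom_D \<and>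
     \<gamma> 0 \<in> dom_DE - Gamma_set \<and> (\<forall>s\<in>{0..<1}. \<gamma> s \<in> dom_D - Gamma_set) \<and> \<gamma> 1 = C"

text \<open>The defining relations are imposed for \<^term>\<open>s < (1::real)\<close> only: the end point values of
  chi and chi-bar are obtained by continuity.  At \<^term>\<open>s = (0::real)\<close> the two roots are
  complex conjugate and not real, so \<^term>\<open>Im (z 0) > 0\<close> fixes the labelling.\<close>

definition chi_lift ::
  "(real \<Rightarrow> 'n::finite conf) \<Rightarrow> (real \<Rightarrow> complex) \<Rightarrow> (real \<Rightarrow> complex)
    \<Rightarrow> (real \<Rightarrow> complex) \<Rightarrow> (real \<Rightarrow> complex) \<Rightarrow> bool" where
  "chi_lift \<gamma> z zb chi chib \<longleftrightarrow>
     continuous_on {0..<1} z \<and> continuous_on {0..<1} zb \<and>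
     (\<forall>s\<in>{0..<1}. is_z_pair (\<gamma> s) (z s) (zb s)) \<and> Im (z 0) > 0 \<and>
     continuous_on {0..1} chi \<and> continuous_on {0..1} chib \<and>
     (\<forall>s\<in>{0..<1}. rho (z s) = exp (\<i> * chi s) \<and> rho (zb s) = exp (\<i> * chib s)) \<and>
     0 \<le> Re (chi 0) \<and> Re (chi 0) \<le> pi \<and> - pi \<le> Re (chib 0) \<and> Re (chib 0) \<le> 0"

definition chi_end :: "(real \<Rightarrow> 'n::finite conf) \<Rightarrow> complex" where
  "chi_end \<gamma> = (THE w. \<exists>z zb chi chib. chi_lift \<gamma> z zb chi chib \<and> w = chi 1)"

definition chib_end :: "(real \<Rightarrow> 'n::finite conf) \<Rightarrow> complex" where
  "chib_end \<gamma> = (THE w. \<exists>z zb chi chib. chi_lift \<gamma> z zb chi chib \<and> w = chib 1)"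


section \<open>The radial expansion\<close>

text \<open>With \<^term>\<open>\<nu> = real d / 2 - 1\<close>, the Gegenbauer polynomial \<open>C\<^sub>l\<^sup>\<nu>(cos \<theta>)\<close> is the sum of
  \<^term>\<open>gegen_coeff d l k * cis ((real l - 2 * real k) * \<theta>)\<close> over \<^term>\<open>k \<le> l\<close>.  For
  \<^term>\<open>d = 2\<close> and \<^term>\<open>l \<ge> 1\<close> that polynomial vanishes identically and is, as usual, replaced by
  the limit of \<open>C\<^sub>l\<^sup>\<nu> / \<nu>\<close>, which is \<^term>\<open>2 / real l * cos (real l * \<theta>)\<close>.\<close>

definition gegen_coeff :: "nat \<Rightarrow> nat \<Rightarrow> nat \<Rightarrow> real" where
  "gegen_coeff d l k =
     (if d = 2 then (if l = 0 then 1 else if k = 0 \<or> k = l then 1 / real l else 0)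
      else pochhammer (real d / 2 - 1) k * pochhammer (real d / 2 - 1) (l - k)
             / (fact k * fact (l - k)))"

lemma gegen_coeff_sym: "k \<le> l \<Longrightarrow> gegen_coeff d l k = gegen_coeff d l (l - k)"
  by (auto simp: gegen_coeff_def mult.commute)

text \<open>The angular factor for \<open>\<rho> = r e\<^sup>i\<^sup>\<theta>\<close> and \<open>\<rho>b = r e\<^sup>-\<^sup>i\<^sup>\<theta>\<close>, as a function of
  \<^term>\<open>q = sgn \<rho>\<close>, which is the square root \<open>e\<^sup>i\<^sup>\<theta>\<close> of \<open>\<rho> / \<rho>b\<close>.\<close>

definition P_ang :: "nat \<Rightarrow> nat \<Rightarrow> complex \<Rightarrow> complex" where
  "P_ang d l q = (\<Sum>k\<le>l. of_real (gegen_coeff d l k) * q powi (int l - 2 * int k))"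

text \<open>The coefficient of \<open>\<rho>\<^sup>h \<rho>b\<^sup>h\<^sup>b\<close> after expanding \<open>(\<rho> \<rho>b)\<^sup>\<delta>\<^sup>/\<^sup>2 P\<^sup>l\<close>: the term
  \<^term>\<open>k\<close> has \<^term>\<open>h = \<delta> / 2 + real l / 2 - real k\<close> and
  \<^term>\<open>hb = \<delta> / 2 - real l / 2 + real k\<close>.\<close>

definition b_coeff :: "nat \<Rightarrow> (real \<Rightarrow> nat \<Rightarrow> real) \<Rightarrow> real \<Rightarrow> real \<Rightarrow> real" where
  "b_coeff d c h hb =
     (\<Sum>\<^sub>\<infinity>(l, k)\<in>{(l, k). k \<le> l \<and> real l - 2 * real k = h - hb}. c (h + hb) l * gegen_coeff d l k)"

definition g_term ::
  "nat \<Rightarrow> (real \<Rightarrow> nat \<Rightarrow> real) \<Rightarrow> complex \<Rightarrow> complex \<Rightarrow> real \<times> real \<Rightarrow> complex" where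
  "g_term d c chi chib = (\<lambda>(h, hb). of_real (b_coeff d c h hb)
      * exp (\<i> * of_real h * chi + \<i> * of_real hb * chib))"

definition g_series :: "nat \<Rightarrow> (real \<Rightarrow> nat \<Rightarrow> real) \<Rightarrow> complex \<Rightarrow> complex \<Rightarrow> complex" where
  "g_series d c chi chib = infsum (g_term d c chi chib) ({0..} \<times> {0..})"


section \<open>The Euclidean four-point function and its continuation\<close>

text \<open>The standing properties of the Euclidean four-point function: \<^term>\<open>g\<close> is the function of
  the cross-ratios and \<^term>\<open>c\<close> the coefficients of its radial expansion.  In the last clause
  \<open>\<rho> = exp (i chi)\<close>, so that its complex conjugate is \<open>exp (i chib)\<close> with
  \<^term>\<open>chib = - cnj chi\<close>.\<close>

definition euclidean_four_point ::
  "real \<Rightarrow> (real \<Rightarrow> nat \<Rightarrow> real) \<Rightarrow> (complex \<Rightarrow> complex \<Rightarrow> complex) \<Rightarrow> ('n::finite conf \<Rightarrow> complex) \<Rightarrow> bool" where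
  "euclidean_four_point \<Delta> c g GE \<longleftrightarrow> (let d = CARD('n) + 1 in
     (\<forall>\<pi>. bij \<pi> \<longrightarrow> (\<forall>C\<in>euclidean_confs. GE (permute_conf \<pi> C) = GE C)) \<and>
     (\<forall>C\<in>euclidean_confs. GE C = g (cr_u C) (cr_v C)
        / (xsq 1 2 C powr of_real \<Delta> * xsq 3 4 C powr of_real \<Delta>)) \<and>
     (\<forall>\<delta>\<ge>0. \<forall>l. c \<delta> l \<ge> 0) \<and>
     (\<forall>C\<in>(euclidean_confs :: 'n conf set). \<forall>z. is_z_pair C z (cnj z) \<and> z \<notin> complex_of_real ` {1..} \<longrightarrow>
        ((\<lambda>(\<delta>, l). of_real (c \<delta> l * cmod (rho z) powr \<delta>) * P_ang d l (sgn (rho z)))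
           has_sum g (cr_u C) (cr_v C)) ({0..} \<times> UNIV)) \<and>
     (\<forall>h hb. b_coeff d c h hb \<ge> 0) \<and>
     (\<forall>h hb. b_coeff d c h hb \<noteq> 0 \<longrightarrow> h \<ge> 0 \<and> hb \<ge> 0 \<and> h - hb \<in> \<int>) \<and>
     (\<forall>chi chib. Im chi > 0 \<and> Im chib > 0 \<longrightarrow>
        (\<lambda>p. norm (g_term d c chi chib p)) summable_on ({0..} \<times> {0..})) \<and>
     (\<forall>C\<in>(euclidean_confs :: 'n conf set). \<forall>z chi. is_z_pair C z (cnj z) \<and> z \<notin> complex_of_real ` {1..}
        \<and> rho z = exp (\<i> * chi) \<longrightarrow> g (cr_u C) (cr_v C) = g_series d c chi (- cnj chi)))"

text \<open>Analytic in the times (complex Frechet differentiable in the four times jointly) and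
  continuous in the spatial points; meant for open \<^term>\<open>S\<close>.\<close>

definition analytic_in_times :: "'n::finite conf set \<Rightarrow> ('n conf \<Rightarrow> complex) \<Rightarrow> bool" where
  "analytic_in_times S F \<longleftrightarrow> continuous_on S F \<and>
     (\<forall>(\<tau>, X)\<in>S. \<exists>D. ((\<lambda>\<tau>'. F (\<tau>', X)) has_derivative D) (at \<tau>) \<and>
        (\<forall>a w. D (a *s w) = a * D w))"

definition continued_four_point ::
  "real \<Rightarrow> (real \<Rightarrow> nat \<Rightarrow> real) \<Rightarrow> ('n::finite conf \<Rightarrow> complex) \<Rightarrow> ('n conf \<Rightarrow> complex) \<Rightarrow> bool" where
  "continued_four_point \<Delta> c GE G \<longleftrightarrow>
     analytic_in_times dom_D G \<and> (\<forall>C\<in>dom_DE. G C = GE C) \<and>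
     (\<forall>C\<in>dom_D. \<forall>\<gamma>. admissible \<gamma> C \<longrightarrow>
        G C = g_series (CARD('n) + 1) c (chi_end \<gamma>) (chib_end \<gamma>) / prefactor \<Delta> C)"

definition analytic_at_boundary :: "('n::finite conf \<Rightarrow> complex) \<Rightarrow> 'n conf \<Rightarrow> bool" where
  "analytic_at_boundary G C \<longleftrightarrow>
     (\<exists>U F. open U \<and> C \<in> U \<and> analytic_in_times U F \<and> (\<forall>C'\<in>U \<inter> dom_D. F C' = G C'))"

text \<open>\<^term>\<open>L\<close> is the value of \<^term>\<open>G\<close> at the Lorentzian configuration \<^term>\<open>C\<close>.\<close>

definition has_lorentzian_value :: "('n::finite conf \<Rightarrow> complex) \<Rightarrow> 'n conf \<Rightarrow> complex \<Rightarrow> bool" where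
  "has_lorentzian_value G C L \<longleftrightarrow>
     ((\<lambda>e::real^4. G ((\<chi> k. of_real (e $ k) + fst C $ k), snd C)) \<longlongrightarrow> L)
       (at 0 within {e. e $ 1 > e $ 2 \<and> e $ 2 > e $ 3 \<and> e $ 3 > e $ 4})"

end

theory Submission
  imports Defs "HOL-Complex_Analysis.Cauchy_Integral_Formula"
begin

text \<open>On the domain the continuation is the series evaluated at the lift of any admissible path.
  The configurations with coinciding roots have real codimension two, so every convex open part of
  the domain stays connected without them.  Near a Lorentzian configuration off the cut the roots
  and the logarithms of the radial variables extend across the boundary.  Where the two roots
  collide they are not analytic separately, but the series is symmetric in them: exchanging the
  roots only moves a winding number from one argument to the other, and this is invisible because
  the spins are integers.  The extension is therefore continuous, and holomorphic in each time
  separately because the collisions are isolated on a complex line, or else the two roots agree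
  along the whole line.  Joint analyticity in the times follows from Osgood's lemma.\<close>

section \<open>Separately holomorphic continuous functions\<close>

text \<open>The formula for \<open>G\<close> concerns paths ending in \<open>dom_D\<close>, so it
  says nothing about \<open>CL\<close> itself. The local extension is therefore calibrated at one
  collision-free point \<open>C1\<close> of the domain near \<open>CL\<close>, along one arbitrarily
  chosen path. Other paths may arrive near \<open>CL\<close> with different labels and windings;
  that they all give the same \<open>G\<close> is part of the hypotheses, so one chart serves all of
  them. A path ending at \<open>CL\<close> is compared with the chart through its truncations to
  \<open>[0, s]\<close>, which end in \<open>dom_D\<close>, and then \<open>s\<close> tends to 1.
  The powers need separate care: a squared distance may be a negative real number at
  \<open>CL\<close>, where the principal power jumps, so its branch is continued from
  \<open>dom_D\<close> by a logarithm based at \<open>CL\<close>. The hypothesis excludes roots on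
  the open ray above 1, whereas logarithms of \<open>rho\<close> also break down at 0 and 1; there
  \<open>cr_u\<close> or \<open>cr_v\<close> would vanish, i.e. some pair would be
  lightlike.\<close>

lemma norm_axis_eq: "norm (axis k t :: 'a::real_normed_vector ^ 'k) = norm t"
proof -
  have "norm (axis k t :: 'a ^ 'k) = sqrt (\<Sum>i\<in>UNIV. if i = k then (norm t)\<^sup>2 else 0)"
    unfolding norm_vec_def L2_set_def axis_def by (intro arg_cong[of _ _ sqrt] sum.cong) auto
  then show ?thesis by simp
qed

text \<open>Cauchy's inequality on a circle of radius \<open>r\<close>, applied to the difference of
  two parallel slices of \<open>f\<close>: a modulus of continuity of \<open>f\<close> becomes one
  of its partial derivatives.\<close>

lemma partial_deriv_bound:
  fixes f :: "complex ^ 'k \<Rightarrow> complex"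
  assumes r: "r > 0" and S: "cball x (2 * r) \<subseteq> S" and y: "dist y x < r"
    and cont: "continuous_on S f"
    and hol: "\<And>x k. x \<in> S \<Longrightarrow> (\<lambda>t. f (x + axis k t)) field_differentiable (at 0)"
    and bd: "\<And>a b. a \<in> cball x (2 * r) \<Longrightarrow> b \<in> cball x (2 * r) \<Longrightarrow> dist a b = dist y x \<Longrightarrow>
          norm (f a - f b) \<le> B"
  shows "norm (deriv (\<lambda>t. f (y + axis k t)) 0 - deriv (\<lambda>t. f (x + axis k t)) 0) \<le> B / r"
proof -
  \<comment> \<open>A shift by \<open>r\<close> from a point within \<open>r\<close> of
    \<open>x\<close> stays in the ball of radius \<open>2 * r\<close>.\<close>
  have mem: "y + axis k t \<in> cball x (2 * r)" "x + axis k t \<in> cball x (2 * r)" if "norm t \<le> r" for t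
  proof -
    have "norm (y - x + axis k t) \<le> norm (y - x) + norm (axis k t)" by (rule norm_triangle_ineq)
    also have "\<dots> \<le> 2 * r" using that y by (simp add: dist_norm norm_axis_eq)
    finally show "y + axis k t \<in> cball x (2 * r)"
      by (simp add: dist_norm norm_minus_commute algebra_simps)
    show "x + axis k t \<in> cball x (2 * r)"
      using that r by (simp add: dist_norm norm_axis_eq)
  qed
  \<comment> \<open>\<open>hol\<close> differentiates at parameter 0 only, so the slice is recentred
    at \<open>w + axis k t\<close>.\<close>
  have fd: "(\<lambda>t. f (w + axis k t)) field_differentiable (at t)" if "w + axis k t \<in> S" for w t
  proof -
    have "(\<lambda>s. f ((w + axis k t) + axis k s)) field_differentiable (at (t - t))"
      using hol[OF that] by simp
    then have "((\<lambda>s. f ((w + axis k t) + axis k s)) \<circ> (\<lambda>s. s - t)) field_differentiable (at t)"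
      by (intro field_differentiable_compose[of "\<lambda>s. s - t", unfolded o_def[symmetric]] derivative_intros)
         (auto intro!: field_differentiable_diff)
    moreover have "w + axis k t + axis k (s - t) = w + axis k s" for s
      by (simp add: vec_eq_iff axis_def)
    ultimately show ?thesis by (simp add: o_def)
  qed
  have hol1: "(\<lambda>t. f (w + axis k t)) holomorphic_on ball 0 r"
    if "w = x \<or> w = y" for w
    using that mem S by (auto simp: holomorphic_on_def dist_norm subset_iff
        intro!: field_differentiable_at_within fd)
  have cont_axis: "continuous_on A (\<lambda>t. w + axis k t :: complex ^ 'k)" for A w
  proof -
    have "continuous_on A (\<lambda>t. if i = k then t else (0::complex))" for i
      by (cases "i = k") auto
    then show ?thesis
      unfolding axis_def by (intro continuous_intros continuous_on_vec_lambda)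
  qed
  have cont1: "continuous_on (cball 0 r) (\<lambda>t. f (w + axis k t))" if "w = x \<or> w = y" for w
    using that mem S
    by (intro continuous_on_compose2[OF cont cont_axis]) (auto simp: dist_norm subset_iff)
  have D: "norm ((deriv ^^ 1) (\<lambda>t. f (y + axis k t) - f (x + axis k t)) 0) \<le> fact 1 * B / r ^ 1"
  proof (rule Cauchy_inequality[OF _ _ r])
    fix t :: complex assume t: "norm (0 - t) = r"
    show "norm (f (y + axis k t) - f (x + axis k t)) \<le> B"
      using t mem[of t] by (intro bd) (auto simp: dist_norm)
  qed (use hol1 cont1 in \<open>auto intro!: holomorphic_intros continuous_intros\<close>)
  have "deriv (\<lambda>t. f (y + axis k t) - f (x + axis k t)) 0 =
      deriv (\<lambda>t. f (y + axis k t)) 0 - deriv (\<lambda>t. f (x + axis k t)) 0"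
    using mem[of 0] S r by (intro deriv_diff fd) auto
  with D show ?thesis by simp
qed

text \<open>The partial derivatives are continuous by \<open>partial_deriv_bound\<close>, and
  continuous complex partials give a complex linear total derivative by changing one coordinate at a
  time.\<close>

lemma osgood:
  fixes f :: "complex ^ 'k \<Rightarrow> complex"
  assumes S: "open S" and cont: "continuous_on S f" and x: "x \<in> S"
    and hol: "\<And>x k. x \<in> S \<Longrightarrow> (\<lambda>t. f (x + axis k t)) field_differentiable (at 0)"
  shows "\<exists>D. (f has_derivative D) (at x) \<and> (\<forall>a w. D (a *s w) = a * D w)"
proof -
  obtain R where R: "R > 0" "cball x R \<subseteq> S" using S x open_contains_cball by blast
  define r where "r = R / 2"
  have r: "r > 0" "cball x (2 * r) \<subseteq> S" using R by (auto simp: r_def)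
  define p where "p k y = deriv (\<lambda>t. f (y + axis k t)) 0" for k y
  define D where "D h = (\<Sum>k\<in>UNIV. p k x * h $ k)" for h :: "complex ^ 'k"
  have blD: "bounded_linear D"
    unfolding D_def by (intro bounded_linear_sum bounded_linear_const_mult bounded_linear_vec_nth)
  have near: "\<exists>d>0. \<forall>y. dist y x < d \<longrightarrow> y \<in> S \<and> (\<forall>k. norm (p k y - p k x) \<le> e)" if e: "e > 0" for e
  proof -
    \<comment> \<open>The tolerance \<open>e * r\<close> compensates the division by
      \<open>r\<close> in Cauchy's inequality.\<close>
    have "uniformly_continuous_on (cball x (2 * r)) f"
      using r cont by (intro compact_uniformly_continuous continuous_on_subset[OF cont]) auto
    then obtain d where d: "d > 0" "\<And>a b. a \<in> cball x (2 * r) \<Longrightarrow> b \<in> cball x (2 * r) \<Longrightarrow>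
        dist a b < d \<Longrightarrow> dist (f a) (f b) < e * r"
      unfolding uniformly_continuous_on_def using e r by (metis mult_pos_pos dist_commute)
    show ?thesis
    proof (intro exI[of _ "min d r"] conjI allI impI)
      show "min d r > 0" using d r by simp
      fix y assume y: "dist y x < min d r"
      show "y \<in> S" using y r by (auto simp: subset_iff dist_commute)
      fix k
      have "norm (p k y - p k x) \<le> (e * r) / r"
        unfolding p_def using y
        by (intro partial_deriv_bound[OF r _ cont hol]) (use d(2) in \<open>force simp: dist_norm\<close>)+
      then show "norm (p k y - p k x) \<le> e" using r by simp
    qed
  qed
  have "(f has_derivative D) (at x)"
    unfolding has_derivative_at_alt
  proof (intro conjI blD allI impI)
    fix e :: real assume e: "e > 0"
    \<comment> \<open>Each of the \<open>CARD('k)\<close> coordinate steps will cost at most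
      \<open>e' * norm h\<close>.\<close>
    define e' where "e' = e / real CARD('k)"
    have e': "e' > 0" using e by (simp add: e'_def)
    obtain d where d: "d > 0" "\<And>y. dist y x < d \<Longrightarrow> y \<in> S"
      "\<And>y k. dist y x < d \<Longrightarrow> norm (p k y - p k x) \<le> e'"
      using near[OF e'] by blast
    have *: "norm (f y - f x - D (y - x)) \<le> e * norm (y - x)" if y: "norm (y - x) < d" for y
    proof -
      define h where "h = y - x"
      \<comment> \<open>\<open>trunc A\<close> has taken the steps in the directions of
        \<open>A\<close>; no intermediate point is further from \<open>x\<close> than
        \<open>y\<close>, so the partials stay controlled on the way.\<close>
      define trunc where "trunc A = (\<chi> k. if k \<in> A then h $ k else 0)" for A
      have tr_le: "norm (trunc A + axis k t) \<le> norm h" if "k \<notin> A" "norm t \<le> norm (h $ k)" for A k t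
        using that by (intro norm_le_componentwise_cart) (auto simp: trunc_def axis_def)
      have step: "norm (f (x + trunc (insert k A)) - f (x + trunc A) - p k x * h $ k) \<le> e' * norm (h $ k)"
        if k: "k \<notin> A" for k A
      proof -
        let ?w = "x + trunc A"
        \<comment> \<open>Without its linear part the slice has a derivative of norm at most
          \<open>e'\<close>, and the mean value inequality bounds the increment.\<close>
        let ?F = "\<lambda>t. f (?w + axis k t) - p k x * t"
        have dist: "dist (?w + axis k t) x < d" if "norm t \<le> norm (h $ k)" for t
          using tr_le[OF k that] y by (simp add: dist_norm h_def algebra_simps)
        have "(?F has_field_derivative (p k (?w + axis k t) - p k x)) (at t within cball 0 (norm (h $ k)))"
          if t: "t \<in> cball 0 (norm (h $ k))" for t
        proof -
          have "?w + axis k t \<in> S" using dist t d by simp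
          from hol[OF this, of k] have "((\<lambda>s. f (?w + axis k t + axis k s)) has_field_derivative p k (?w + axis k t)) (at (t - t))"
            unfolding p_def by (simp add: DERIV_deriv_iff_field_differentiable)
          then have "((\<lambda>s. f (?w + axis k t + axis k (s - t))) has_field_derivative p k (?w + axis k t) * 1) (at t)"
            by (rule DERIV_chain2) (auto intro!: derivative_eq_intros)
          moreover have "?w + axis k t + axis k (s - t) = ?w + axis k s" for s
            by (simp add: vec_eq_iff axis_def)
          ultimately have "((\<lambda>s. f (?w + axis k s)) has_field_derivative p k (?w + axis k t)) (at t)"
            by simp
          from DERIV_diff[OF this DERIV_cmult_Id[of "p k x"]] show ?thesis
            by (rule has_field_derivative_at_within)
        qed
        then have "norm (?F (h $ k) - ?F 0) \<le> e' * norm (h $ k - 0)"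
          by (rule field_differentiable_bound[OF convex_cball]) (use d dist in auto)
        moreover have "?w + axis k (h $ k) = x + trunc (insert k A)"
          using k by (auto simp: vec_eq_iff axis_def trunc_def)
        moreover have "?w + axis k 0 = ?w" by (simp add: vec_eq_iff axis_def)
        ultimately show ?thesis by (simp only: mult_zero_right diff_zero) (simp add: algebra_simps)
      qed
      have ind: "norm (f (x + trunc A) - f x - (\<Sum>k\<in>A. p k x * h $ k)) \<le> (\<Sum>k\<in>A. e' * norm (h $ k))"
        if "finite A" for A
        using that
      proof (induction A)
        case empty
        have "x + trunc {} = x" by (simp add: vec_eq_iff trunc_def)
        then show ?case by simp
      next
        case (insert k A)
        have "f (x + trunc (insert k A)) - f x - (\<Sum>k\<in>insert k A. p k x * h $ k) =
          (f (x + trunc (insert k A)) - f (x + trunc A) - p k x * h $ k) +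
          (f (x + trunc A) - f x - (\<Sum>k\<in>A. p k x * h $ k))"
          using insert by simp
        then show ?case
          using insert step[of k A] norm_triangle_ineq by (smt (verit, best) sum.insert)
      qed
      have "x + trunc UNIV = y" by (simp add: vec_eq_iff trunc_def h_def)
      with ind[of UNIV] have "norm (f y - f x - D (y - x)) \<le> (\<Sum>k\<in>UNIV. e' * norm (h $ k))"
        by (simp add: D_def h_def)
      also have "\<dots> \<le> (\<Sum>k\<in>(UNIV :: 'k set). e' * norm h)"
        using e' by (intro sum_mono mult_left_mono) (auto simp: Finite_Cartesian_Product.norm_nth_le)
      also have "\<dots> = e * norm (y - x)" by (simp add: e'_def h_def)
      finally show ?thesis .
    qed
    then show "\<exists>d>0. \<forall>y. norm (y - x) < d \<longrightarrow> norm (f y - f x - D (y - x)) \<le> e * norm (y - x)"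
      using d(1) by blast
  qed
  moreover have "D (a *s w) = a * D w" for a w
    by (simp add: D_def sum_distrib_left algebra_simps)
  ultimately show ?thesis by blast
qed

section \<open>Logarithms and roots\<close>

lemma constant_on_int_shift:
  fixes f :: "'a::topological_space \<Rightarrow> complex"
  assumes "connected S" "continuous_on S f" "\<And>x. x \<in> S \<Longrightarrow> f x \<in> \<int>"
  shows "\<exists>n. \<forall>x\<in>S. f x = of_int n"
proof (cases "S = {}")
  case False
  have "f constant_on S"
  proof (rule continuous_discrete_range_constant[OF assms(1,2)])
    fix x assume x: "x \<in> S"
    show "\<exists>e>0. \<forall>y. y \<in> S \<and> f y \<noteq> f x \<longrightarrow> e \<le> norm (f y - f x)"
    proof (intro exI[of _ 1] conjI allI impI)
      fix y assume y: "y \<in> S \<and> f y \<noteq> f x"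
      with x assms(3) obtain m n where "f x = of_int m" "f y = of_int n" by (meson Ints_cases)
      moreover from this y have "m \<noteq> n" by auto
      ultimately show "1 \<le> norm (f y - f x)"
        by (simp flip: of_int_diff of_int_abs)
    qed simp
  qed
  then show ?thesis using assms(3) False unfolding constant_on_def by (metis Ints_cases)
qed simp

text \<open>The difference divided by \<open>2 * pi\<close> is continuous and integer valued on a
  connected set.\<close>

lemma exp_eq_imp_const_shift:
  fixes f g :: "'a::topological_space \<Rightarrow> complex"
  assumes S: "connected S" and cont: "continuous_on S f" "continuous_on S g"
    and eq: "\<And>x. x \<in> S \<Longrightarrow> exp (\<i> * f x) = exp (\<i> * g x)"
  shows "\<exists>n::int. \<forall>x\<in>S. f x = g x + 2 * pi * of_int n"
proof -
  have "(f x - g x) / (2 * pi) \<in> \<int>" if xS: "x \<in> S" for x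
  proof -
    obtain n :: int where "\<i> * f x = \<i> * g x + (of_int (2 * n) * pi) * \<i>"
      using eq[OF xS] by (auto simp: exp_eq)
    then have "\<i> * f x = \<i> * (g x + of_int (2 * n) * pi)" by (simp add: algebra_simps)
    then have "f x = g x + of_int (2 * n) * pi" by (subst (asm) mult_left_cancel) auto
    then have "(f x - g x) / (2 * pi) = of_int n" by (simp add: field_simps)
    then show ?thesis by simp
  qed
  moreover have "continuous_on S (\<lambda>x. (f x - g x) / (2 * pi))"
    by (intro continuous_intros cont) simp
  ultimately obtain n where "\<forall>x\<in>S. (f x - g x) / (2 * pi) = of_int n"
    using constant_on_int_shift[OF S] by blast
  then show ?thesis by (intro exI[of _ n]) (auto simp: field_simps)
qed

text \<open>The shift is one integer for all of \<open>S\<close>, and less than a full turn at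
  \<open>x0\<close> makes it 0.\<close>

lemma exp_eq_imp_eq:
  fixes f g :: "'a::topological_space \<Rightarrow> complex"
  assumes S: "connected S" "x0 \<in> S" and cont: "continuous_on S f" "continuous_on S g"
    and eq: "\<And>x. x \<in> S \<Longrightarrow> exp (\<i> * f x) = exp (\<i> * g x)"
    and x0: "\<bar>Re (f x0) - Re (g x0)\<bar> < 2 * pi" and x: "x \<in> S"
  shows "f x = g x"
proof -
  obtain n :: int where n: "\<forall>x\<in>S. f x = g x + 2 * pi * of_int n"
    using exp_eq_imp_const_shift[OF S(1) cont eq] by blast
  have "\<bar>2 * pi * of_int n\<bar> < 2 * pi" using n x0 S(2) by simp
  then have "n = 0" by (simp add: abs_mult)
  with n x show ?thesis by simp
qed

section \<open>Roots of a quadratic and square roots along a path\<close>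

lemma vieta_unique:
  fixes a b :: complex
  assumes "a + b = a' + b'" "a * b = a' * b'"
  shows "(a' = a \<and> b' = b) \<or> (a' = b \<and> b' = a)"
proof -
  have "(a' - a) * (a' - b) = a' * (a' - (a + b)) + a * b" by (simp add: algebra_simps)
  also have "\<dots> = a' * (a' - (a' + b')) + a' * b'" by (simp only: assms)
  also have "\<dots> = 0" by (simp add: algebra_simps)
  finally have "a' = a \<or> a' = b" by simp
  with assms(1) show ?thesis by auto
qed

text \<open>Near a double root no continuous labelling exists in general, so continuity is
  formulated for some pair of roots close to \<open>(a, b)\<close>.\<close>

lemma vieta_near:
  fixes a b :: complex
  assumes e: "e > 0"
  shows "\<exists>d>0. \<forall>s p. norm (s - (a + b)) < d \<and> norm (p - a * b) < d \<longrightarrow>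
     (\<exists>a' b'. a' + b' = s \<and> a' * b' = p \<and> norm (a' - a) < e \<and> norm (b' - b) < e)"
proof -
  let ?D = "\<lambda>x :: complex \<times> complex. (fst x)\<^sup>2 - 4 * snd x"
  have "isCont ?D (a + b, a * b)"
    by (intro continuous_intros)
  then obtain d where d: "d > 0" "\<And>x. dist x (a + b, a * b) < d \<Longrightarrow> dist (?D x) (?D (a + b, a * b)) < e\<^sup>2"
    unfolding continuous_at_eps_delta using e by (metis zero_less_power)
  show ?thesis
  proof (intro exI[of _ "min (d / 2) e"] conjI allI impI)
    show "min (d / 2) e > 0" using d e by simp
    fix s p assume sp: "norm (s - (a + b)) < min (d / 2) e \<and> norm (p - a * b) < min (d / 2) e"
    define D where "D = s\<^sup>2 - 4 * p"
    have "dist (s, p) (a + b, a * b) \<le> norm (s - (a + b)) + norm (p - a * b)"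
      using norm_Pair_le[of "s - (a + b)" "p - a * b"] by (simp add: dist_norm)
    then have "norm (D - (a - b)\<^sup>2) < e\<^sup>2"
      using d(2)[of "(s, p)"] sp by (simp add: D_def dist_norm power2_eq_square algebra_simps)
    moreover have "D - (a - b)\<^sup>2 = (csqrt D - (a - b)) * (csqrt D + (a - b))"
      by (simp add: algebra_simps flip: power2_eq_square) (simp add: power2_eq_square algebra_simps)
    ultimately have "norm (csqrt D - (a - b)) * norm (csqrt D + (a - b)) < e * e"
      by (metis norm_mult power2_eq_square)
    \<comment> \<open>A product below \<open>e * e\<close> has a factor below \<open>e\<close>; this
      tells which sign of the square root is the one near \<open>a - b\<close>.\<close>
    then have "norm (csqrt D - (a - b)) < e \<or> norm (csqrt D + (a - b)) < e"
      by (meson e less_imp_le linorder_not_less mult_mono norm_ge_zero order_less_le_trans)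
    then obtain q where q: "q\<^sup>2 = D" "norm (q - (a - b)) < e"
      by (metis minus_diff_eq minus_diff_minus norm_minus_cancel power2_csqrt power2_minus
          diff_minus_eq_add minus_add_distrib add.inverse_inverse uminus_add_conv_diff add.commute)
    have "(s + q) / 2 - a = ((s - (a + b)) + (q - (a - b))) / 2" by (simp add: field_simps)
    then have "norm ((s + q) / 2 - a) = norm ((s - (a + b)) + (q - (a - b))) / 2"
      by (simp only: norm_divide) simp
    also have "\<dots> < e"
      using norm_triangle_ineq[of "s - (a + b)" "q - (a - b)"] q sp by linarith
    finally have A: "norm ((s + q) / 2 - a) < e" .
    have "(s - q) / 2 - b = ((s - (a + b)) - (q - (a - b))) / 2" by (simp add: field_simps)
    then have "norm ((s - q) / 2 - b) = norm ((s - (a + b)) - (q - (a - b))) / 2"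
      by (simp only: norm_divide) simp
    also have "\<dots> < e"
      using norm_triangle_ineq4[of "s - (a + b)" "q - (a - b)"] q sp by linarith
    finally have B: "norm ((s - q) / 2 - b) < e" .
    have "(s + q) / 2 * ((s - q) / 2) = (s\<^sup>2 - q\<^sup>2) / 4" by (simp add: power2_eq_square algebra_simps)
    then have "(s + q) / 2 * ((s - q) / 2) = p" by (simp add: q D_def)
    moreover have "(s + q) / 2 + (s - q) / 2 = s" by (simp add: field_simps)
    ultimately show "\<exists>a' b'. a' + b' = s \<and> a' * b' = p \<and> norm (a' - a) < e \<and> norm (b' - b) < e"
      using A B by blast
  qed
qed

text \<open>An admissible path may end at a collision, where the discriminant vanishes. On the
  half-open interval a branch exists by contractibility, and since its modulus is
  \<open>sqrt (norm (f s))\<close> it tends to 0 at the end whatever its phase does.\<close>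

lemma continuous_sqrt_on_unit_interval:
  fixes f :: "real \<Rightarrow> complex"
  assumes cont: "continuous_on {0..1} f" and nz: "\<And>s. s \<in> {0..<1} \<Longrightarrow> f s \<noteq> 0"
  obtains q where "continuous_on {0..1} q" "\<And>s. s \<in> {0..1} \<Longrightarrow> f s = (q s)\<^sup>2"
proof (cases "f 1 = 0")
  case False
  have "f s \<noteq> 0" if "s \<in> {0..1}" for s
    using that nz[of s] False by (cases "s = 1") auto
  then show ?thesis
    using continuous_sqrt_on_contractible[OF cont convex_imp_contractible[OF convex_closed_interval]] that
    by (metis interval_cbox convex_box(1) convex_imp_contractible cont continuous_sqrt_on_contractible)
next
  case True
  obtain q where q: "continuous_on {0..<1} q" "\<And>s. s \<in> {0..<1} \<Longrightarrow> f s = (q s)\<^sup>2"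
    using continuous_sqrt_on_contractible[of "{0..<1}" f] nz continuous_on_subset[OF cont, of "{0..<1}"]
    by (metis convex_imp_contractible convex_real_interval(7) atLeastLessThan_subseteq_atLeastAtMost_iff order_refl)
  define Q where "Q s = (if s = 1 then 0 else q s)" for s
  have sq: "f s = (Q s)\<^sup>2" if "s \<in> {0..1}" for s
    using that True q(2)[of s] by (auto simp: Q_def)
  have "continuous (at s within {0..1}) Q" if s: "s \<in> {0..1}" for s
  proof (cases "s = 1")
    case True
    have "((\<lambda>x. sqrt (norm (f x))) \<longlongrightarrow> sqrt (norm (f 1))) (at 1 within {0..1})"
      using cont by (intro tendsto_intros) (simp add: continuous_on_def)
    moreover have "sqrt (norm (f x)) = norm (Q x)" if "x \<in> {0..1}" for x
      by (simp add: sq[OF that] norm_power)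
    ultimately have "((\<lambda>x. norm (Q x)) \<longlongrightarrow> 0) (at 1 within {0..1})"
      using \<open>f 1 = 0\<close> Lim_cong_within[of 1 1 "sqrt (norm (f 1))" 0 "{0..1}" "{0..1}"
        "\<lambda>x. sqrt (norm (f x))" "\<lambda>x. norm (Q x)"] by simp
    then have "(Q \<longlongrightarrow> 0) (at 1 within {0..1})" by (rule tendsto_norm_zero_cancel)
    then show ?thesis using True by (simp add: continuous_within Q_def cong del: if_weak_cong)
  next
    case False
    have "continuous_on {0..<1} Q" using q(1) by (auto simp: Q_def cong: continuous_on_cong_simp)
    then have "continuous (at s within {0..<1}) Q"
      using s False by (simp add: continuous_on_eq_continuous_within)
    moreover have "at s within {0..<1} = at s within {0..1}"
      using s False by (intro at_within_nhd[of _ "{..<1}"]) auto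
    ultimately show ?thesis by simp
  qed
  then have "continuous_on {0..1} Q" by (simp add: continuous_on_eq_continuous_within)
  with sq that show ?thesis by blast
qed

section \<open>The radial variable\<close>

text \<open>Off this set \<open>rho\<close> is holomorphic and nonzero with modulus below one, so
  \<open>rho z = exp (\<i> * chi)\<close> has solutions, all with \<open>Im chi > 0\<close>, the
  region where the series converges.\<close>

abbreviation (input) z_cut :: "complex set" where
  "z_cut \<equiv> {0} \<union> complex_of_real ` {1..}"

lemma closed_z_cut: "closed z_cut"
proof -
  have "complex_of_real ` {1..} = {z. Im z = 0 \<and> Re z \<ge> 1}"
    by (auto simp: complex_eq_iff image_iff) 
  moreover have "closed {z. Im z = 0 \<and> Re z \<ge> 1}"
    by (intro closed_Collect_conj closed_Collect_eq closed_Collect_le continuous_intros)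
  ultimately show ?thesis by (simp add: closed_insert)
qed

lemma one_minus_notin_nonpos_Reals: "z \<notin> z_cut \<Longrightarrow> 1 - z \<notin> \<real>\<^sub>\<le>\<^sub>0"
  by (force simp: complex_nonpos_Reals_iff complex_eq_iff image_iff)

text \<open>With \<open>w = csqrt (1 - z)\<close> one has \<open>z = (1 - w) * (1 + w)\<close>, so a
  factor cancels and \<open>rho\<close> is the Cayley transform of \<open>w\<close>, taking the
  right half-plane into the unit disc.\<close>

lemma rho_csqrt:
  assumes "z \<notin> z_cut"
  shows "Re (csqrt (1 - z)) > 0"
    and "rho z = (1 - csqrt (1 - z)) / (1 + csqrt (1 - z))"
proof -
  define w where "w = csqrt (1 - z)"
  have "Re w \<ge> 0" using csqrt_principal[of "1 - z"] by (auto simp: w_def)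
  have w2: "w\<^sup>2 = 1 - z" by (simp add: w_def)
  have "Re w \<noteq> 0"
  proof
    assume "Re w = 0"
    then have "w\<^sup>2 \<in> \<real>\<^sub>\<le>\<^sub>0" by (simp add: complex_nonpos_Reals_iff power2_eq_square)
    with one_minus_notin_nonpos_Reals[OF assms] w2 show False by simp
  qed
  with \<open>Re w \<ge> 0\<close> show re: "Re (csqrt (1 - z)) > 0" by (simp add: w_def)
  have z: "z = (1 - w) * (1 + w)" using w2 by (simp add: algebra_simps power2_eq_square)
  have "1 + w \<noteq> 0"
  proof
    assume "1 + w = 0"
    then have "Re (1 + w) = 0" by simp
    with re show False unfolding w_def by (simp del: csqrt.simps)
  qed
  moreover have "1 - w \<noteq> 0" using assms z by auto
  ultimately show "rho z = (1 - csqrt (1 - z)) / (1 + csqrt (1 - z))"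
    unfolding rho_def w_def[symmetric] by (subst z) (simp add: power2_eq_square)
qed

lemma rho_nonzero: "z \<notin> z_cut \<Longrightarrow> rho z \<noteq> 0"
proof -
  assume z: "z \<notin> z_cut"
  have "csqrt (1 - z) \<noteq> 1"
  proof
    assume "csqrt (1 - z) = 1"
    then have "(csqrt (1 - z))\<^sup>2 = 1" by simp
    then show False using z by (simp del: csqrt.simps)
  qed
  then show ?thesis using z by (simp add: rho_def)
qed

lemma norm_rho_less_1: "z \<notin> z_cut \<Longrightarrow> norm (rho z) < 1"
proof -
  assume z: "z \<notin> z_cut"
  let ?w = "csqrt (1 - z)"
  have "(norm (1 - ?w))\<^sup>2 < (norm (1 + ?w))\<^sup>2"
    using rho_csqrt(1)[OF z] unfolding cmod_power2 by (simp add: power2_eq_square algebra_simps)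
  then have "norm (1 - ?w) < norm (1 + ?w)" by (simp add: power2_less_imp_less)
  then show ?thesis using rho_csqrt(2)[OF z] by (simp add: norm_divide divide_less_eq)
qed

lemma Im_pos_if_exp_eq_rho: "z \<notin> z_cut \<Longrightarrow> rho z = exp (\<i> * w) \<Longrightarrow> Im w > 0"
  using norm_rho_less_1[of z] by simp

text \<open>Both signs are that of \<open>- Im w\<close> for \<open>w = csqrt (1 - z)\<close>. Hence
  the root in the upper half-plane can start with \<open>Re chi\<close> in \<open>[0, pi]\<close>
  and the other one with \<open>Re chib\<close> in \<open>[- pi, 0]\<close>.\<close>

lemma sgn_Im_rho:
  assumes "z \<notin> z_cut"
  shows "sgn (Im (rho z)) = sgn (Im z)"
proof -
  let ?w = "csqrt (1 - z)"
  have re: "Re ?w > 0" by (rule rho_csqrt(1)[OF assms])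
  have nz: "1 + ?w \<noteq> 0"
  proof
    assume "1 + ?w = 0"
    then have "Re (1 + ?w) = 0" by simp
    with re show False by (simp del: csqrt.simps)
  qed
  have "Im (?w\<^sup>2) = Im (1 - z)" by (simp only: power2_csqrt)
  then have im: "Im z = - 2 * Re ?w * Im ?w" by (simp only: Im_power2) simp
  have "Im (rho z) = Im ((1 - ?w) * cnj (1 + ?w)) / (norm (1 + ?w))\<^sup>2"
    unfolding rho_csqrt(2)[OF assms] by (subst complex_div_cnj) (simp only: Im_divide_of_real)
  also have "Im ((1 - ?w) * cnj (1 + ?w)) = - 2 * Im ?w" by (simp add: algebra_simps)
  finally show ?thesis
    using re nz unfolding im by (simp add: sgn_mult sgn_divide)
qed

lemma rho_holomorphic: "S \<inter> z_cut = {} \<Longrightarrow> rho holomorphic_on S"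
  unfolding rho_def
  by (intro holomorphic_intros one_minus_notin_nonpos_Reals[unfolded Un_iff insert_iff]) blast+

section \<open>The discriminant of the cross-ratios\<close>

definition disc :: "'n::finite conf \<Rightarrow> complex" where
  "disc C = (1 + cr_u C - cr_v C)\<^sup>2 - 4 * cr_u C"

text \<open>The Kallen triangle function a^2 + b^2 + c^2 - 2ab - 2bc - 2ca, symmetric in its
  arguments.\<close>

definition kallen :: "'a::comm_ring_1 \<Rightarrow> 'a \<Rightarrow> 'a \<Rightarrow> 'a" where
  "kallen a b c = (a + b - c)\<^sup>2 - 4 * a * b"

text \<open>Clearing the denominators makes the discriminant a polynomial in the times: on a complex
  line it vanishes identically or has finitely many zeros.\<close>

definition disc_num :: "'n::finite conf \<Rightarrow> complex" where
  "disc_num C = kallen (xsq 1 2 C * xsq 3 4 C) (xsq 1 3 C * xsq 2 4 C) (xsq 1 4 C * xsq 2 3 C)"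

lemma disc_eq_disc_num:
  assumes "xsq 1 3 C \<noteq> 0" "xsq 2 4 C \<noteq> 0"
  shows "disc C = disc_num C / (xsq 1 3 C * xsq 2 4 C)\<^sup>2"
proof -
  have "(1 + a / b - c / b)\<^sup>2 - 4 * (a / b) = kallen a b c / b\<^sup>2" if "b \<noteq> 0" for a b c :: complex
    using that by (simp add: kallen_def field_simps power2_eq_square)
  then show ?thesis using assms by (simp add: disc_def disc_num_def cr_u_def cr_v_def)
qed

lemma dom_D_Re_neq: "C \<in> dom_D \<Longrightarrow> i \<noteq> j \<Longrightarrow> Re (fst C $ i) \<noteq> Re (fst C $ j)"
  using exhaust_4[of i] exhaust_4[of j] by (auto simp: dom_D_def)

lemma dom_D_xsq: "C \<in> dom_D \<Longrightarrow> i \<noteq> j \<Longrightarrow> xsq i j C \<notin> \<real>\<^sub>\<le>\<^sub>0"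
  by (intro xsq_notin_nonpos_Reals dom_D_Re_neq)

lemma dom_D_xsq_nonzero: "C \<in> dom_D \<Longrightarrow> i \<noteq> j \<Longrightarrow> xsq i j C \<noteq> 0"
  using dom_D_xsq[of C i j] by auto

lemma mem_Gamma_set_iff: "C \<in> dom_D \<Longrightarrow> C \<in> Gamma_set \<longleftrightarrow> disc C = 0"
  by (auto simp: Gamma_set_def disc_def)

lemma mem_Gamma_set_iff_num: "C \<in> dom_D \<Longrightarrow> C \<in> Gamma_set \<longleftrightarrow> disc_num C = 0"
  by (simp add: mem_Gamma_set_iff disc_eq_disc_num dom_D_xsq_nonzero)

lemma xsq_line: "xsq i j (\<tau> + t *s w, X) =
    poly ([:\<tau> $ i - \<tau> $ j, w $ i - w $ j:]\<^sup>2 + [:of_real ((norm (X $ i - X $ j))\<^sup>2):]) t"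
  by (simp add: xsq_def algebra_simps)

lemma disc_num_line: "\<exists>p. \<forall>t. disc_num (\<tau> + t *s w, X) = poly p t"
proof -
  have "\<exists>p. \<forall>t. xsq i j (\<tau> + t *s w, X) = poly p t" for i j
    using xsq_line by blast
  then obtain q where q: "\<And>i j t. xsq i j (\<tau> + t *s w, X) = poly (q i j) t" by metis
  show ?thesis
    unfolding disc_num_def q
    by (intro exI[of _ "kallen (q 1 2 * q 3 4) (q 1 3 * q 2 4) (q 1 4 * q 2 3)"])
      (simp add: kallen_def)
qed

text \<open>Putting two points at lightlike separation kills one of the three products, after which the
  discriminant is the square of the difference of the other two.\<close>

lemma lightlike_times:
  fixes p_ab p_cd p_ac p_bd p_ad p_bc :: complex
  assumes "p_ab \<noteq> 0"
  shows "\<exists>a b c d. (a - b)\<^sup>2 + p_ab = 0 \<and>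
    ((a - c)\<^sup>2 + p_ac) * ((b - d)\<^sup>2 + p_bd) \<noteq> ((a - d)\<^sup>2 + p_ad) * ((b - c)\<^sup>2 + p_bc)"
proof -
  define b where "b = csqrt (- p_ab)"
  have b2: "b\<^sup>2 = - p_ab" by (simp add: b_def)
  with assms have b: "b \<noteq> 0" by auto
  \<comment> \<open>This value gives \<open>d ^ 2\<close> the coefficient 1 in
    \<open>f d\<close>.\<close>
  define c where "c = (1 + b\<^sup>2 - p_ac + p_bc) / (2 * b)"
  define f where "f d = (c\<^sup>2 + p_ac) * ((b - d)\<^sup>2 + p_bd) - (d\<^sup>2 + p_ad) * ((b - c)\<^sup>2 + p_bc)" for d
  have "2 * b * c = 1 + b\<^sup>2 - p_ac + p_bc" using b by (simp add: c_def)
  then have one: "(c\<^sup>2 + p_ac) - ((b - c)\<^sup>2 + p_bc) = 1"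
    by (simp add: power2_eq_square algebra_simps)
  \<comment> \<open>The second difference is twice the coefficient of \<open>d ^ 2\<close>, so
    \<open>f\<close> cannot vanish at -1, 0 and 1 together.\<close>
  have "f 1 + f (-1) - 2 * f 0 = 2 * ((c\<^sup>2 + p_ac) - ((b - c)\<^sup>2 + p_bc))"
    by (simp add: f_def power2_eq_square algebra_simps)
  then have "f 1 + f (-1) - 2 * f 0 = 2" by (simp only: one) simp
  then obtain d where "f d \<noteq> 0" by force
  then show ?thesis using b2
    by (intro exI[of _ 0] exI[of _ b] exI[of _ c] exI[of _ d]) (simp add: f_def)
qed

text \<open>The first spatial point differs from another one, and complex times can make that pair
  lightlike. The three cases differ in the argument of \<open>kallen\<close> that this
  annihilates.\<close>

lemma disc_num_not_identically_zero:
  fixes X :: "(real ^ 'n::finite) ^ 4"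
  assumes "\<not> (X $ 1 = X $ 2 \<and> X $ 1 = X $ 3 \<and> X $ 1 = X $ 4)"
  shows "\<exists>\<tau>. disc_num (\<tau>, X) \<noteq> 0"
proof -
  define m where "m i j = complex_of_real ((norm (X $ i - X $ j))\<^sup>2)" for i j
  have m_comm: "m i j = m j i" for i j by (simp add: m_def norm_minus_commute)
  have xm: "xsq i j (\<tau>, X) = (\<tau> $ i - \<tau> $ j)\<^sup>2 + m i j" for i j \<tau> by (simp add: xsq_def m_def)
  have vec: "\<exists>\<tau> :: complex ^ 4. \<tau> $ 1 = a \<and> \<tau> $ 2 = b \<and> \<tau> $ 3 = c \<and> \<tau> $ 4 = d" for a b c d
    by (intro exI[of _ "\<chi> k. if k = 1 then a else if k = 2 then b else if k = 3 then c else d"]) simp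
  have kallen0: "kallen 0 y z = (y - z)\<^sup>2" "kallen x 0 z = (x - z)\<^sup>2" "kallen x y 0 = (x - y)\<^sup>2"
    for x y z :: complex
    by (simp_all add: kallen_def power2_eq_square algebra_simps)
  consider "X $ 1 \<noteq> X $ 2" | "X $ 1 \<noteq> X $ 3" | "X $ 1 \<noteq> X $ 4" using assms by blast
  then show ?thesis
  proof cases
    case 1
    then have "m 1 2 \<noteq> 0" by (simp add: m_def)
    from lightlike_times[OF this, of "m 1 3" "m 2 4" "m 1 4" "m 2 3"]
    obtain a b c d where *: "(a - b)\<^sup>2 + m 1 2 = 0"
      "((a - c)\<^sup>2 + m 1 3) * ((b - d)\<^sup>2 + m 2 4) \<noteq> ((a - d)\<^sup>2 + m 1 4) * ((b - c)\<^sup>2 + m 2 3)" by blast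
    obtain \<tau> :: "complex ^ 4" where "\<tau> $ 1 = a" "\<tau> $ 2 = b" "\<tau> $ 3 = c" "\<tau> $ 4 = d" using vec by blast
    with * show ?thesis by (intro exI[of _ \<tau>]) (simp add: disc_num_def xm kallen0)
  next
    case 2
    then have "m 1 3 \<noteq> 0" by (simp add: m_def)
    from lightlike_times[OF this, of "m 1 2" "m 3 4" "m 1 4" "m 2 3"]
    obtain a b c d where *: "(a - b)\<^sup>2 + m 1 3 = 0"
      "((a - c)\<^sup>2 + m 1 2) * ((b - d)\<^sup>2 + m 3 4) \<noteq> ((a - d)\<^sup>2 + m 1 4) * ((b - c)\<^sup>2 + m 2 3)" by blast
    obtain \<tau> :: "complex ^ 4" where "\<tau> $ 1 = a" "\<tau> $ 2 = c" "\<tau> $ 3 = b" "\<tau> $ 4 = d" using vec by blast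
    with * show ?thesis
      by (intro exI[of _ \<tau>]) (simp add: disc_num_def xm kallen0 power2_commute[of c b])
  next
    case 3
    then have "m 1 4 \<noteq> 0" by (simp add: m_def)
    from lightlike_times[OF this, of "m 1 2" "m 3 4" "m 1 3" "m 2 4"]
    obtain a b c d where *: "(a - b)\<^sup>2 + m 1 4 = 0"
      "((a - c)\<^sup>2 + m 1 2) * ((b - d)\<^sup>2 + m 3 4) \<noteq> ((a - d)\<^sup>2 + m 1 3) * ((b - c)\<^sup>2 + m 2 4)" by blast
    obtain \<tau> :: "complex ^ 4" where "\<tau> $ 1 = a" "\<tau> $ 2 = c" "\<tau> $ 3 = d" "\<tau> $ 4 = b" using vec by blast
    with * show ?thesis
      by (intro exI[of _ \<tau>]) (simp add: disc_num_def xm kallen0 power2_commute[of c b] power2_commute[of d b])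
  qed
qed

text \<open>The squared distances are squares of time differences \<open>t_ij\<close>, and the
  identity \<open>t_12 * t_34 + t_14 * t_23 = t_13 * t_24\<close> makes the Kallen function of the
  squared products vanish.\<close>

lemma disc_num_zero_if_all_equal:
  assumes "X $ 1 = X $ 2" "X $ 1 = X $ 3" "X $ 1 = X $ 4"
  shows "disc_num (\<tau>, X) = 0"
  using assms by (simp add: disc_num_def kallen_def xsq_def power2_eq_square algebra_simps)

section \<open>Topology of the domain and of its collision-free part\<close>

lemma continuous_on_xsq [continuous_intros]: "continuous_on S (xsq i j)"
  unfolding xsq_def by (intro continuous_intros)

lemma continuous_on_disc_num: "continuous_on S disc_num"
  unfolding disc_num_def kallen_def by (intro continuous_intros)

lemma continuous_on_cr:
  assumes "\<And>C. C \<in> S \<Longrightarrow> xsq 1 3 C \<noteq> 0 \<and> xsq 2 4 C \<noteq> 0"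
  shows "continuous_on S cr_u" "continuous_on S cr_v" "continuous_on S disc"
proof -
  show u: "continuous_on S cr_u" and v: "continuous_on S cr_v"
    unfolding cr_u_def cr_v_def using assms by (auto intro!: continuous_intros)
  show "continuous_on S disc"
    unfolding disc_def by (intro continuous_intros u v)
qed

lemma open_dom_D: "open dom_D"
  unfolding dom_D_def by (intro open_Collect_conj open_Collect_less continuous_intros)

lemma convex_dom_D: "convex (dom_D :: 'n::finite conf set)"
proof -
  have "convex {C :: 'n conf. 0 < Re (fst C $ i - fst C $ j)}" for i j
  proof -
    have "linear (\<lambda>C :: 'n conf. Re (fst C $ i - fst C $ j))"
      by (intro linearI) (simp_all add: algebra_simps)
    from convex_linear_vimage[OF this convex_real_interval(3)[of 0]] show ?thesis
      by (simp add: vimage_def)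
  qed
  from convex_Int[OF this[of 1 2] convex_Int[OF this[of 2 3] this[of 3 4]]] show ?thesis
    by (simp add: dom_D_def Collect_conj_eq Int_assoc)
qed

lemma finite_disc_num_zeros_on_line:
  assumes "disc_num (\<tau> + t0 *s w, X) \<noteq> 0"
  shows "finite {t. disc_num (\<tau> + t *s w, X) = 0}"
proof -
  obtain p where p: "\<And>t. disc_num (\<tau> + t *s w, X) = poly p t" using disc_num_line by blast
  with assms have "p \<noteq> 0" by force
  then show ?thesis unfolding p by (rule poly_roots_finite)
qed

lemma continuous_on_line:
  fixes \<tau> w :: "complex ^ 'k"
  assumes "continuous_on S f"
  shows "continuous_on S (\<lambda>t. \<tau> + f t *s w)"
  unfolding vector_scalar_mult_def by (intro continuous_intros continuous_on_vec_lambda assms)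

text \<open>The complex line towards times with nonzero discriminant meets \<open>V\<close> in an
  infinite set and the collisions in a finite one.\<close>

lemma ex_disc_num_nonzero_fibre:
  fixes X :: "(real ^ 'n::finite) ^ 4"
  assumes V: "open V" "(\<tau>, X) \<in> V" and X: "\<not> (X $ 1 = X $ 2 \<and> X $ 1 = X $ 3 \<and> X $ 1 = X $ 4)"
  shows "\<exists>\<tau>'. (\<tau>', X) \<in> V \<and> disc_num (\<tau>', X) \<noteq> 0"
proof -
  obtain \<tau>1 where \<tau>1: "disc_num (\<tau>1, X) \<noteq> 0" using disc_num_not_identically_zero[OF X] by blast
  define w where "w = \<tau>1 - \<tau>"
  have "finite {t. disc_num (\<tau> + t *s w, X) = 0}"
    by (rule finite_disc_num_zeros_on_line[of _ 1]) (use \<tau>1 in \<open>simp add: w_def\<close>)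
  moreover have "infinite {t. (\<tau> + t *s w, X) \<in> V}"
  proof -
    have "open ((\<lambda>t. (\<tau> + t *s w, X)) -` V)"
      by (intro open_vimage V continuous_intros continuous_on_line)
    moreover have "0 \<in> (\<lambda>t. (\<tau> + t *s w, X)) -` V" using V by simp
    ultimately have "infinite ((\<lambda>t. (\<tau> + t *s w, X)) -` V)"
      using finite_imp_not_open by blast
    then show ?thesis by (simp add: vimage_def)
  qed
  ultimately obtain t where "t \<in> {t. (\<tau> + t *s w, X) \<in> V} - {t. disc_num (\<tau> + t *s w, X) = 0}"
    by (metis Diff_infinite_finite ex_in_conv finite.emptyI)
  then show ?thesis by blast
qed

lemma ex_disc_num_nonzero:
  fixes V :: "'n::finite conf set"
  assumes V: "open V" "V \<noteq> {}"
  shows "\<exists>C\<in>V. disc_num C \<noteq> 0"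
proof -
  obtain \<tau> X where C: "(\<tau>, X) \<in> V" using V(2) by auto
  obtain X' where X': "(\<tau>, X') \<in> V" "X' $ 1 \<noteq> X' $ 2"
  proof (cases "X $ 1 = X $ 2")
    case True
    have "open ((\<lambda>Y. (\<tau>, Y)) -` V)"
      by (intro open_vimage V continuous_intros)
    then obtain e where e: "e > 0" "ball X e \<subseteq> (\<lambda>Y. (\<tau>, Y)) -` V"
      using C open_contains_ball by blast
    \<comment> \<open>Half the radius keeps the perturbed configuration in \<open>V\<close>; moving
      the first point alone separates it from the second.\<close>
    define d :: "real ^ 'n" where "d = axis undefined (e / 2)"
    have "norm (axis 1 d :: (real ^ 'n) ^ 4) = e / 2"
      using e by (simp add: norm_axis_eq d_def)
    then have "X + axis 1 d \<in> ball X e" using e by (simp add: dist_norm)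
    moreover have "d \<noteq> 0" using e by (auto simp: d_def axis_def vec_eq_iff)
    then have "(X + axis 1 d) $ 1 \<noteq> (X + axis 1 d) $ 2" using True by (simp add: axis_def)
    ultimately show ?thesis using that e by blast
  qed (use C that in blast)
  then show ?thesis using ex_disc_num_nonzero_fibre[OF V(1) X'(1)] by blast
qed

text \<open>Coordinates modulo spatial translations. The squared distances see space only through
  them, and they are all zero exactly on the fibres where the discriminant vanishes for every choice
  of times.\<close>

definition space_diffs :: "'n::finite conf \<Rightarrow> (real ^ 'n) \<times> (real ^ 'n) \<times> (real ^ 'n)" where
  "space_diffs C = (snd C $ 1 - snd C $ 2, snd C $ 1 - snd C $ 3, snd C $ 1 - snd C $ 4)"

lemma space_diffs_eqD:
  assumes "space_diffs C = space_diffs C'"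
  shows "snd C $ i - snd C $ j = snd C' $ i - snd C' $ j"
proof -
  have "snd C $ 1 - snd C $ k = snd C' $ 1 - snd C' $ k" for k
    using assms exhaust_4[of k] by (auto simp: space_diffs_def)
  then have "(snd C $ 1 - snd C $ j) - (snd C $ 1 - snd C $ i) =
      (snd C' $ 1 - snd C' $ j) - (snd C' $ 1 - snd C' $ i)"
    by (simp only:)
  then show ?thesis by simp
qed

lemma linear_space_diffs: "linear space_diffs"
  by (intro linearI) (simp_all add: space_diffs_def algebra_simps)

lemma surj_space_diffs: "surj space_diffs"
proof (rule surjI)
  show "space_diffs (0, \<chi> k. if k = 1 then 0 else if k = 2 then - fst y
      else if k = 3 then - fst (snd y) else - snd (snd y)) = y" for y :: "(real ^ 'n::finite) \<times> (real ^ 'n) \<times> (real ^ 'n)"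
    by (simp add: space_diffs_def)
qed

text \<open>Over fixed spatial differences two configurations are joined by a complex line on which the
  discriminant has finitely many zeros; the spatial differences themselves range over a connected
  set because only the origin, of codimension at least three, is excluded.\<close>

lemma connected_disc_num_nonzero:
  fixes V :: "'n::finite conf set"
  assumes V: "open V" "convex V"
  shows "connected {C \<in> V. disc_num C \<noteq> 0}"
proof -
  let ?S = "{C \<in> V. disc_num C \<noteq> 0}"
  let ?T = "space_diffs ` V - {0}"
  have openS: "open ?S"
  proof -
    have "open (V \<inter> disc_num -` (- {0}))"
      using V by (intro continuous_open_preimage continuous_on_disc_num) auto
    then show ?thesis by (simp add: vimage_def Int_def)
  qed
  have not_all: "\<not> (X $ 1 = X $ 2 \<and> X $ 1 = X $ 3 \<and> X $ 1 = X $ 4) \<longleftrightarrow> space_diffs (\<tau>, X) \<noteq> 0"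
    for \<tau> and X :: "(real ^ 'n) ^ 4"
    by (auto simp: space_diffs_def zero_prod_def)
  have im: "space_diffs ` ?S = ?T"
  proof (intro equalityI subsetI)
    fix y assume "y \<in> space_diffs ` ?S"
    then obtain \<tau> X where "(\<tau>, X) \<in> V" "disc_num (\<tau>, X) \<noteq> 0" "y = space_diffs (\<tau>, X)" by auto
    moreover from this have "space_diffs (\<tau>, X) \<noteq> 0"
      using disc_num_zero_if_all_equal[of X \<tau>] not_all[of X \<tau>] by blast
    ultimately show "y \<in> ?T" by (metis DiffI imageI singletonD)
  next
    fix y assume "y \<in> ?T"
    then obtain \<tau> X where C: "(\<tau>, X) \<in> V" "y = space_diffs (\<tau>, X)" "y \<noteq> 0" by auto
    then obtain \<tau>' where "(\<tau>', X) \<in> V" "disc_num (\<tau>', X) \<noteq> 0"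
      using ex_disc_num_nonzero_fibre[OF V(1)] not_all by metis
    moreover have "y = space_diffs (\<tau>', X)" using C by (simp add: space_diffs_def)
    ultimately show "y \<in> space_diffs ` ?S" by blast
  qed
  have openim: "open (space_diffs ` A)" if "open A" for A :: "'n conf set"
    by (rule open_surjective_linear_image[OF that linear_space_diffs surj_space_diffs])
  \<comment> \<open>Deleting a point keeps a connected open set connected in dimension at least two;
    here the dimension is \<open>3 * CARD('n)\<close>.\<close>
  have "2 \<le> DIM((real ^ 'n) \<times> (real ^ 'n) \<times> (real ^ 'n))"
  proof -
    have "CARD('n) > 0" by simp
    then show ?thesis by (simp del: zero_less_card_finite)
  qed
  then have connT: "connected ?T"
    using V by (intro connected_open_delete openim convex_connected convex_linear_image linear_space_diffs)
  \<comment> \<open>\<open>space_diffs\<close> maps open sets to open sets, so connected fibres over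
    a connected base make the whole set connected.\<close>
  have "connected (?S \<inter> space_diffs -` ?T)"
  proof (rule connected_open_monotone_preimage[OF _ im _ _ connT order_refl])
    show "continuous_on ?S space_diffs"
      by (rule linear_continuous_on) (simp add: linear_space_diffs linear_conv_bounded_linear[symmetric])
    show "openin (top_of_set ?T) (space_diffs ` A)" if A: "openin (top_of_set ?S) A" for A
    proof -
      have "open (space_diffs ` A)" using A openS openim openin_open_eq by blast
      moreover have "space_diffs ` A \<subseteq> ?T" using openin_imp_subset[OF A] im by blast
      ultimately show ?thesis by (simp add: open_subset)
    qed
    fix y assume "y \<in> ?T"
    show "connected (?S \<inter> space_diffs -` {y})"
      unfolding connected_iff_connected_component
    proof (intro ballI)
      fix C0 C1 assume C: "C0 \<in> ?S \<inter> space_diffs -` {y}" "C1 \<in> ?S \<inter> space_diffs -` {y}"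
      define w where "w = fst C1 - fst C0"
      \<comment> \<open>Points of one fibre may still differ by a spatial translation. It is carried
        out along \<open>Re t\<close>, which keeps \<open>L\<close> affine over the reals and leaves
        the discriminant polynomial in \<open>t\<close>.\<close>
      define L where "L t = (fst C0 + t *s w, snd C0 + Re t *\<^sub>R (snd C1 - snd C0))" for t
      have L01: "L 0 = C0" "L 1 = C1" by (simp_all add: L_def w_def)
      have diffs: "snd C1 $ i - snd C1 $ j = snd C0 $ i - snd C0 $ j" for i j
        by (rule space_diffs_eqD) (use C in simp)
      have Ldiff: "snd (L t) $ i - snd (L t) $ j = snd C0 $ i - snd C0 $ j" for t i j
      proof -
        have "snd (L t) $ i - snd (L t) $ j = (snd C0 $ i - snd C0 $ j) +
            Re t *\<^sub>R ((snd C1 $ i - snd C1 $ j) - (snd C0 $ i - snd C0 $ j))"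
          by (simp add: L_def scaleR_diff_right)
        then show ?thesis by (simp only: diffs diff_self scaleR_zero_right add_0_right)
      qed
      have disc: "disc_num (L t) = disc_num (fst C0 + t *s w, snd C0)" for t
        using Ldiff[of t] by (simp add: disc_num_def xsq_def) (simp add: L_def)
      have sd: "space_diffs (L t) = y" for t
        using C Ldiff[of t] by (simp add: space_diffs_def)
      have contL: "continuous_on A L" for A
        unfolding L_def by (intro continuous_intros continuous_on_line)
      let ?W = "L -` V" and ?Z = "{t. disc_num (fst C0 + t *s w, snd C0) = 0}"
      have "open ?W" by (intro open_vimage V contL)
      moreover have "convex ?W"
      proof -
        have "L ((1 - u) *\<^sub>R a + u *\<^sub>R b) = (1 - u) *\<^sub>R L a + u *\<^sub>R L b" for u a b
          by (simp add: L_def vec_eq_iff algebra_simps scaleR_conv_of_real[where 'a=complex])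
        then show ?thesis using V(2) by (auto simp: convex_alt)
      qed
      moreover have "finite ?Z"
        by (rule finite_disc_num_zeros_on_line[of _ 0]) (use C in simp)
      ultimately have "path_connected (?W - ?Z)"
        by (intro path_connected_open_diff_countable) (auto intro: convex_connected countable_finite)
      then have "connected (L ` (?W - ?Z))"
        using contL by (intro connected_continuous_image path_connected_imp_connected)
      moreover have "L ` (?W - ?Z) \<subseteq> ?S \<inter> space_diffs -` {y}"
      proof (rule image_subsetI)
        fix t assume "t \<in> ?W - ?Z"
        then show "L t \<in> ?S \<inter> space_diffs -` {y}" using disc[of t] sd[of t] by simp
      qed
      moreover have "0 \<in> ?W - ?Z" "1 \<in> ?W - ?Z"
        using C disc[of 0] disc[of 1] by (simp_all add: L01)
      then have "C0 \<in> L ` (?W - ?Z)" "C1 \<in> L ` (?W - ?Z)"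
        using L01 by (metis imageI)+
      ultimately show "connected_component (?S \<inter> space_diffs -` {y}) C0 C1"
        unfolding connected_component_def by blast
    qed
  qed
  moreover have "?S \<inter> space_diffs -` ?T = ?S" using im by blast
  ultimately show ?thesis by simp
qed

lemma path_connected_diff_Gamma_set:
  fixes V :: "'n::finite conf set"
  assumes V: "open V" "convex V" "V \<subseteq> dom_D"
  shows "path_connected (V - Gamma_set)"
proof -
  have eq: "V - Gamma_set = {C \<in> V. disc_num C \<noteq> 0}"
    using V(3) by (auto simp: mem_Gamma_set_iff_num subset_iff)
  have "open (V \<inter> disc_num -` (- {0}))"
    using V by (intro continuous_open_preimage continuous_on_disc_num) auto
  then have "open (V - Gamma_set)" unfolding eq by (simp add: vimage_def Int_def)
  then show ?thesis
    using connected_disc_num_nonzero[OF V(1,2)] connected_open_path_connected unfolding eq by blast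
qed

section \<open>Euclidean configurations\<close>

text \<open>Inversion in the unit sphere turns Ptolemy's inequality into the triangle
  inequality.\<close>

lemma ptolemy_origin:
  fixes x y z :: "'a::real_inner"
  shows "norm (x - y) * norm z \<le> norm (x - z) * norm y + norm (y - z) * norm x"
proof (cases "x = 0 \<or> y = 0 \<or> z = 0")
  case True
  then show ?thesis
    by (auto simp: mult.commute intro: order_trans[OF _ mult_right_mono[OF norm_triangle_ineq4]])
next
  case False
  define inv where "inv v = v /\<^sub>R (norm v)\<^sup>2" for v :: 'a
  have dist_inv: "norm (inv a - inv b) = norm (a - b) / (norm a * norm b)" if "a \<noteq> 0" "b \<noteq> 0" for a b
  proof -
    have "(norm (inv a - inv b))\<^sup>2 = (norm (a - b) / (norm a * norm b))\<^sup>2"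
      using that
      by (simp add: inv_def power2_norm_eq_inner power_divide power_mult_distrib inner_diff_left
          inner_diff_right inner_commute field_simps)
    then show ?thesis by (simp add: power2_eq_iff_nonneg)
  qed
  have "norm (inv x - inv y) \<le> norm (inv x - inv z) + norm (inv y - inv z)"
    by (metis norm_minus_commute norm_triangle_sub norm_diff_triangle_le order_refl)
  then show ?thesis using False by (simp add: dist_inv field_simps)
qed

lemma ptolemy:
  fixes x y z w :: "'a::real_inner"
  shows "norm (x - y) * norm (z - w) \<le> norm (x - z) * norm (y - w) + norm (y - z) * norm (x - w)"
  using ptolemy_origin[of "x - w" "y - w" "z - w"] by simp

text \<open>Heron's formula: the left side is minus sixteen times the squared area of a triangle
  with sides \<open>a\<close>, \<open>b\<close>, \<open>c\<close>.\<close>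

lemma kallen_nonpos:
  fixes a b c :: real
  assumes "a \<ge> 0" "b \<ge> 0" "c \<ge> 0" "a \<le> b + c" "b \<le> a + c" "c \<le> a + b"
  shows "kallen (a\<^sup>2) (b\<^sup>2) (c\<^sup>2) \<le> 0"
proof -
  have "kallen (a\<^sup>2) (b\<^sup>2) (c\<^sup>2) = - (((a + b - c) * (a + b + c)) * ((b + c - a) * (a + c - b)))"
    by (simp add: kallen_def power2_eq_square algebra_simps)
  moreover have "0 \<le> ((a + b - c) * (a + b + c)) * ((b + c - a) * (a + c - b))"
    using assms by (intro mult_nonneg_nonneg) auto
  ultimately show ?thesis by simp
qed

text \<open>By Ptolemy the products of opposite distances satisfy the triangle inequalities, so the
  discriminant is nonpositive and the two roots are complex conjugates.\<close>

lemma euclidean_cross_ratios: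
  assumes C: "C \<in> dom_DE"
  obtains s \<delta> :: real where "1 + cr_u C - cr_v C = of_real s" "disc C = of_real \<delta>" "\<delta> \<le> 0"
proof -
  have D: "C \<in> dom_D" using C by (simp add: dom_DE_def)
  define P where "P k = (Re (fst C $ k), snd C $ k)" for k
  define r where "r i j = norm (P i - P j)" for i j
  have x: "xsq i j C = of_real ((r i j)\<^sup>2)" for i j
  proof -
    have "fst C $ i - fst C $ j = of_real (Re (fst C $ i) - Re (fst C $ j))"
      using C by (simp add: dom_DE_def complex_eq_iff)
    then show ?thesis by (simp add: xsq_def r_def P_def norm_Pair) 
  qed
  define a b c where "a = r 1 2 * r 3 4" and "b = r 1 3 * r 2 4" and "c = r 1 4 * r 2 3"
  have b0: "b \<noteq> 0" using dom_D_xsq_nonzero[OF D, of 1 3] dom_D_xsq_nonzero[OF D, of 2 4] by (simp add: x b_def)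
  have pt: "r i j * r k l \<le> r i k * r j l + r j k * r i l" for i j k l
    unfolding r_def by (rule ptolemy)
  have comm: "r i j = r j i" for i j by (simp add: r_def norm_minus_commute)
  have "kallen (a\<^sup>2) (b\<^sup>2) (c\<^sup>2) \<le> 0"
  proof (rule kallen_nonpos)
    show "a \<ge> 0" "b \<ge> 0" "c \<ge> 0" by (simp_all add: a_def b_def c_def r_def)
    show "a \<le> b + c" using pt[of 1 2 3 4] by (simp add: a_def b_def c_def comm mult.commute)
    show "b \<le> a + c" using pt[of 1 3 2 4] comm[of 3 2] by (simp add: a_def b_def c_def mult.commute)
    show "c \<le> a + b" using pt[of 1 4 2 3] comm[of 4 2] comm[of 4 3] by (simp add: a_def b_def c_def mult.commute)
  qed
  moreover have "disc C = of_real (kallen (a\<^sup>2) (b\<^sup>2) (c\<^sup>2) / (b\<^sup>2)\<^sup>2)"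
    using disc_eq_disc_num[of C] dom_D_xsq_nonzero[OF D, of 1 3] dom_D_xsq_nonzero[OF D, of 2 4]
    by (simp add: disc_num_def kallen_def x a_def b_def c_def power_mult_distrib)
  moreover have "1 + cr_u C - cr_v C = of_real (1 + a\<^sup>2 / b\<^sup>2 - c\<^sup>2 / b\<^sup>2)"
    by (simp add: cr_u_def cr_v_def x a_def b_def c_def power_mult_distrib)
  ultimately show ?thesis using that by (simp add: divide_nonpos_nonneg del: of_real_diff of_real_add of_real_divide)
qed

lemma ex_dom_DE_diff_Gamma_set: "\<exists>C :: 'n::finite conf. C \<in> dom_DE - Gamma_set"
proof -
  \<comment> \<open>Three points on the time axis and a fourth one off it: they share no circle or
    line, so Ptolemy's inequality is strict.\<close>
  define \<tau> :: "complex ^ 4" where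
    "\<tau> = (\<chi> k. if k = 1 then 3 else if k = 2 then 2 else if k = 3 then 1 else 0)"
  define X :: "(real ^ 'n) ^ 4" where "X = (\<chi> k. if k = 1 then axis undefined 1 else 0)"
  have D: "(\<tau>, X) \<in> dom_DE" by (simp add: dom_DE_def dom_D_def \<tau>_def)
  moreover have "disc_num (\<tau>, X) \<noteq> 0"
    by (simp add: disc_num_def kallen_def xsq_def \<tau>_def X_def norm_axis_eq)
  ultimately show ?thesis using mem_Gamma_set_iff_num[of "(\<tau>, X)"] by (auto simp: dom_DE_def)
qed

section \<open>Lifting paths to the variables chi and chi-bar\<close>

text \<open>What the points of \<open>dom_D\<close> and the given Lorentzian point have in common,
  and what a lift needs at every point of its path, the end included.\<close>

definition regular :: "'n::finite conf \<Rightarrow> bool" where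
  "regular C \<longleftrightarrow> (\<forall>i j. i \<noteq> j \<longrightarrow> xsq i j C \<noteq> 0) \<and>
     (\<forall>z zb. is_z_pair C z zb \<longrightarrow> z \<notin> z_cut \<and> zb \<notin> z_cut)"

lemma regular_z_cut:
  assumes "regular C" "is_z_pair C z zb"
  shows "z \<notin> z_cut" "zb \<notin> z_cut"
  using assms unfolding regular_def by (metis (no_types))+

lemma is_z_pair_iff: "is_z_pair C z zb \<longleftrightarrow> z + zb = 1 + cr_u C - cr_v C \<and> z * zb = cr_u C"
  unfolding is_z_pair_def by (auto simp: algebra_simps)

lemma is_z_pair_commute: "is_z_pair C z zb \<longleftrightarrow> is_z_pair C zb z"
  by (simp add: is_z_pair_iff add.commute mult.commute)

lemma disc_eq_diff_squared:
  assumes "is_z_pair C z zb"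
  shows "disc C = (z - zb)\<^sup>2"
proof -
  have "disc C = (z + zb)\<^sup>2 - 4 * (z * zb)"
    using assms by (simp only: is_z_pair_iff disc_def)
  then show ?thesis by (simp add: power2_eq_square algebra_simps)
qed

lemma disc_nonzero: "C \<in> dom_D - Gamma_set \<Longrightarrow> disc C \<noteq> 0"
  using mem_Gamma_set_iff by blast

lemma is_z_pair_sqrt_disc:
  assumes "q\<^sup>2 = disc C"
  shows "is_z_pair C ((1 + cr_u C - cr_v C + q) / 2) ((1 + cr_u C - cr_v C - q) / 2)"
proof -
  define s where "s = 1 + cr_u C - cr_v C"
  have "(s + q) / 2 * ((s - q) / 2) = (s\<^sup>2 - q\<^sup>2) / 4"
    by (simp add: power2_eq_square algebra_simps)
  also have "\<dots> = cr_u C" by (simp add: assms disc_def s_def)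
  finally have "(s + q) / 2 * ((s - q) / 2) = cr_u C" .
  moreover have "(s + q) / 2 + (s - q) / 2 = s" by (simp add: field_simps)
  ultimately show ?thesis unfolding is_z_pair_iff s_def[symmetric] by blast
qed

lemma ex_is_z_pair: "\<exists>z zb. is_z_pair C z zb"
  using is_z_pair_sqrt_disc[of "csqrt (disc C)" C] by auto

lemma is_z_pair_unique:
  "is_z_pair C a b \<Longrightarrow> is_z_pair C a' b' \<Longrightarrow> (a' = a \<and> b' = b) \<or> (a' = b \<and> b' = a)"
  by (rule vieta_unique) (auto simp: is_z_pair_iff)

text \<open>Compared with \<open>chi_lift\<close>, the roots and the relations reach the end point
  and no starting values are prescribed, so lifts can be joined and truncated.\<close>

definition full_lift ::
  "(real \<Rightarrow> 'n::finite conf) \<Rightarrow> (real \<Rightarrow> complex) \<Rightarrow> (real \<Rightarrow> complex)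
    \<Rightarrow> (real \<Rightarrow> complex) \<Rightarrow> (real \<Rightarrow> complex) \<Rightarrow> bool" where
  "full_lift \<gamma> z zb chi chib \<longleftrightarrow> path z \<and> path zb \<and> path chi \<and> path chib \<and>
     (\<forall>s\<in>{0..1}. is_z_pair (\<gamma> s) (z s) (zb s) \<and>
        rho (z s) = exp (\<i> * chi s) \<and> rho (zb s) = exp (\<i> * chib s))"

lemma ex_log_rho_lift:
  assumes z: "path z" and cut: "\<And>s. s \<in> {0..1} \<Longrightarrow> z s \<notin> z_cut" and w: "rho (z 0) = exp (\<i> * w)"
  shows "\<exists>chi. path chi \<and> chi 0 = w \<and> (\<forall>s\<in>{0..1}. rho (z s) = exp (\<i> * chi s))"
proof -
  have "continuous_on {0..1} (\<lambda>s. rho (z s))"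
  proof (rule continuous_on_compose2[where s = "{0..1}" and f = z and g = rho and t = "- z_cut"])
    show "continuous_on (- z_cut) rho"
      by (intro holomorphic_on_imp_continuous_on rho_holomorphic) blast
    show "z ` {0..1} \<subseteq> - z_cut" by (intro image_subsetI) (simp only: Compl_iff cut not_False_eq_True)
  qed (use z in \<open>simp add: path_def\<close>)
  moreover have "rho (z s) \<noteq> 0" if "s \<in> {0..1}" for s
    using rho_nonzero[OF cut[OF that]] .
  ultimately obtain l where l: "continuous_on {0..1} l" "\<And>s. s \<in> {0..1} \<Longrightarrow> rho (z s) = exp (l s)"
    using continuous_logarithm_on_contractible[of "{0..1}" "\<lambda>s. rho (z s)"]
    by (metis convex_imp_contractible convex_real_interval(5))
  define chi where "chi s = w - \<i> * (l s - l 0)" for s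
  have "exp (\<i> * chi s) = rho (z s)" if s: "s \<in> {0..1}" for s
  proof -
    have "\<i> * chi s = \<i> * w + (l s - l 0)" by (simp add: chi_def algebra_simps)
    then have "exp (\<i> * chi s) = exp (\<i> * w) * exp (l s) / exp (l 0)"
      by (simp only: exp_add exp_diff) simp
    also have "\<dots> = rho (z s)" using l(2)[of 0] l(2)[OF s] w by simp
    finally show ?thesis .
  qed
  moreover have "path chi" unfolding path_def chi_def by (intro continuous_intros l)
  ultimately show ?thesis by (intro exI[of _ chi]) (simp add: chi_def)
qed

lemma ex_full_lift:
  assumes path: "path \<gamma>" and reg: "\<And>s. s \<in> {0..1} \<Longrightarrow> regular (\<gamma> s)"
    and disc: "\<And>s. s \<in> {0..<1} \<Longrightarrow> disc (\<gamma> s) \<noteq> 0"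
    and init: "is_z_pair (\<gamma> 0) a b" "rho a = exp (\<i> * w)" "rho b = exp (\<i> * wb)"
  shows "\<exists>z zb chi chib. full_lift \<gamma> z zb chi chib \<and> z 0 = a \<and> zb 0 = b \<and> chi 0 = w \<and> chib 0 = wb"
proof -
  let ?u = "\<lambda>s. cr_u (\<gamma> s)" and ?v = "\<lambda>s. cr_v (\<gamma> s)"
  have nz: "xsq 1 3 C \<noteq> 0 \<and> xsq 2 4 C \<noteq> 0" if "C \<in> \<gamma> ` {0..1}" for C
    using that reg by (auto simp: regular_def)
  have cont: "continuous_on {0..1} ?u" "continuous_on {0..1} ?v" "continuous_on {0..1} (\<lambda>s. disc (\<gamma> s))"
    using path nz unfolding path_def
    by (auto intro!: continuous_on_compose2[OF continuous_on_cr(1)[OF nz]]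
        continuous_on_compose2[OF continuous_on_cr(2)[OF nz]] continuous_on_compose2[OF continuous_on_cr(3)[OF nz]])
  obtain q where q: "continuous_on {0..1} q" "\<And>s. s \<in> {0..1} \<Longrightarrow> disc (\<gamma> s) = (q s)\<^sup>2"
    using continuous_sqrt_on_unit_interval[OF cont(3) disc] by blast
  have "(q 0)\<^sup>2 = (a - b)\<^sup>2" using q(2)[of 0] disc_eq_diff_squared[OF init(1)] by simp
  \<comment> \<open>The sign \<open>\<sigma>\<close> adapts the square root to the prescribed labels
    \<open>a\<close> and \<open>b\<close>.\<close>
  then obtain \<sigma> where \<sigma>: "\<sigma>\<^sup>2 = 1" "\<sigma> * q 0 = a - b"
    unfolding power2_eq_iff by (auto intro: that[of 1] that[of "- 1"])
  define z zb where "z s = (1 + ?u s - ?v s + \<sigma> * q s) / 2"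
    and "zb s = (1 + ?u s - ?v s - \<sigma> * q s) / 2" for s
  have pair: "is_z_pair (\<gamma> s) (z s) (zb s)" if "s \<in> {0..1}" for s
    unfolding z_def zb_def using q(2)[OF that] \<sigma>(1)
    by (intro is_z_pair_sqrt_disc) (simp add: power_mult_distrib)
  have pz: "path z" "path zb"
    unfolding path_def z_def zb_def by (intro continuous_intros cont q; simp)+
  have z0: "z 0 = a" "zb 0 = b"
    using init(1) \<sigma>(2) by (auto simp: z_def zb_def is_z_pair_iff field_simps dest: sym)
  have cut: "z s \<notin> z_cut" "zb s \<notin> z_cut" if "s \<in> {0..1}" for s
    using regular_z_cut[OF reg pair] that by simp_all
  obtain chi where "path chi" "chi 0 = w" "\<forall>s\<in>{0..1}. rho (z s) = exp (\<i> * chi s)"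
    using ex_log_rho_lift[OF pz(1) cut(1)] z0 init by blast
  moreover obtain chib where "path chib" "chib 0 = wb" "\<forall>s\<in>{0..1}. rho (zb s) = exp (\<i> * chib s)"
    using ex_log_rho_lift[OF pz(2) cut(2)] z0 init by blast
  ultimately show ?thesis
    using pair pz z0 unfolding full_lift_def by blast
qed

lemma full_lift_join:
  assumes "full_lift \<gamma>1 z1 zb1 chi1 chib1" "full_lift \<gamma>2 z2 zb2 chi2 chib2"
    and "z1 1 = z2 0" "zb1 1 = zb2 0" "chi1 1 = chi2 0" "chib1 1 = chib2 0"
  shows "full_lift (\<gamma>1 +++ \<gamma>2) (z1 +++ z2) (zb1 +++ zb2) (chi1 +++ chi2) (chib1 +++ chib2)"
proof -
  have "is_z_pair ((\<gamma>1 +++ \<gamma>2) s) ((z1 +++ z2) s) ((zb1 +++ zb2) s) \<and>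
      rho ((z1 +++ z2) s) = exp (\<i> * (chi1 +++ chi2) s) \<and>
      rho ((zb1 +++ zb2) s) = exp (\<i> * (chib1 +++ chib2) s)" if s: "s \<in> {0..1}" for s
  proof (cases "s \<le> 1 / 2")
    case True
    then have "2 * s \<in> {0..1}" using s by simp
    with True show ?thesis using assms(1) by (simp add: full_lift_def joinpaths_def)
  next
    case False
    then have "2 * s - 1 \<in> {0..1}" using s by simp
    with False show ?thesis using assms(2) by (simp add: full_lift_def joinpaths_def)
  qed
  then show ?thesis
    using assms unfolding full_lift_def
    by (auto intro!: path_join_imp simp: pathfinish_def pathstart_def)
qed

lemma full_lift_scale:
  assumes "full_lift \<gamma> z zb chi chib" "0 \<le> s" "s \<le> 1"
  shows "full_lift (\<lambda>t. \<gamma> (s * t)) (\<lambda>t. z (s * t)) (\<lambda>t. zb (s * t)) (\<lambda>t. chi (s * t)) (\<lambda>t. chib (s * t))"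
proof -
  have mem: "s * t \<in> {0..1}" if "t \<in> {0..1}" for t :: real
    using that assms(2,3) by (auto intro: mult_le_one)
  have "path (\<lambda>t. f (s * t))" if "path f" for f :: "real \<Rightarrow> complex"
  proof -
    have "continuous_on {0..1} (\<lambda>t. s * t)" by (intro continuous_intros)
    then show ?thesis
      using that mem unfolding path_def by (metis continuous_on_compose2 image_subsetI)
  qed
  then show ?thesis using assms(1) mem unfolding full_lift_def by simp
qed

text \<open>A truncated path ends inside \<open>dom_D\<close>, where the formula for
  \<open>G\<close> is available.\<close>

lemma admissible_scale:
  assumes "admissible \<gamma> C" "0 < s" "s < 1"
  shows "admissible (\<lambda>t. \<gamma> (s * t)) (\<gamma> s)"
proof -
  have mem: "s * t \<in> {0..<1}" if "t \<in> {0..1}" for t :: real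
  proof -
    have "s * t \<le> s" using that assms(2) by (intro mult_left_le) auto
    then have "s * t < 1" using assms(3) by (rule le_less_trans)
    then show ?thesis using that assms(2) by simp
  qed
  have D: "\<gamma> (s * t) \<in> dom_D - Gamma_set" if "t \<in> {0..1}" for t
    using assms(1) mem[OF that] unfolding admissible_def by blast
  have "path (\<lambda>t. \<gamma> (s * t))"
  proof -
    have "continuous_on {0..1} (\<lambda>t. s * t)" by (intro continuous_intros)
    moreover have "s * t \<in> {0..1}" if "t \<in> {0..1}" for t using mem[OF that] by simp
    ultimately show ?thesis
      using assms(1) unfolding path_def admissible_def by (metis continuous_on_compose2 image_subsetI)
  qed
  moreover have "path_image (\<lambda>t. \<gamma> (s * t)) \<subseteq> closure dom_D"
    using D closure_subset unfolding path_image_def by blast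
  ultimately show ?thesis using assms(1) D by (auto simp: admissible_def)
qed

text \<open>This gives meaning to the definite descriptions \<open>chi_end\<close> and
  \<open>chib_end\<close>: away from collisions the labels cannot be exchanged, and the starting
  strips fix the logarithms.\<close>

lemma chi_lift_unique:
  assumes adm: "admissible \<gamma> C" and l: "chi_lift \<gamma> z zb chi chib" "chi_lift \<gamma> z' zb' chi' chib'"
  shows "chi 1 = chi' 1 \<and> chib 1 = chib' 1"
proof -
  let ?I = "{0..<1::real}"
  have conn: "connected ?I" by (intro convex_connected) simp
  note cont = l(1)[unfolded chi_lift_def] l(2)[unfolded chi_lift_def]
  have pair: "is_z_pair (\<gamma> s) (z s) (zb s)" "is_z_pair (\<gamma> s) (z' s) (zb' s)" if "s \<in> ?I" for s
    using cont that by blast+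
  have neq: "z s \<noteq> zb s" if "s \<in> ?I" for s
  proof -
    have "\<gamma> s \<in> dom_D - Gamma_set" using adm that by (simp add: admissible_def)
    then have "disc (\<gamma> s) \<noteq> 0" by (rule disc_nonzero)
    then show ?thesis using disc_eq_diff_squared[OF pair(1)[OF that]] by simp
  qed
  \<comment> \<open>\<open>f\<close> is 1 where the two labellings agree and 0 where they are
    exchanged; the signs of the imaginary parts at the start rule out 0.\<close>
  define f where "f s = (z' s - zb s) / (z s - zb s)" for s
  have f01: "f s = 0 \<or> f s = 1" if "s \<in> ?I" for s
    using is_z_pair_unique[OF pair[OF that]] neq[OF that] by (auto simp: f_def)
  have "continuous_on ?I f"
    unfolding f_def using cont neq by (intro continuous_intros) auto
  moreover have "f s \<in> \<int>" if "s \<in> ?I" for s using f01[OF that] by auto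
  ultimately obtain n where n: "\<forall>s\<in>?I. f s = of_int n"
    using constant_on_int_shift[OF conn] by blast
  have "\<gamma> 0 \<in> dom_DE" using adm by (simp add: admissible_def)
  then obtain r \<delta> :: real where "1 + cr_u (\<gamma> 0) - cr_v (\<gamma> 0) = of_real r"
    by (rule euclidean_cross_ratios)
  then have "z 0 + zb 0 = of_real r" using pair(1)[of 0] by (simp add: is_z_pair_iff)
  then have "Im (z 0 + zb 0) = 0" by simp
  then have "Im (zb 0) < 0" using cont by simp
  moreover have "Im (z' 0) > 0" using cont by simp
  ultimately have "z' 0 \<noteq> zb 0" by auto
  then have "f 0 \<noteq> 0" using neq[of 0] by (simp add: f_def)
  then have f1: "f s = 1" if "s \<in> ?I" for s
    using f01[of 0] n that by (metis atLeastLessThan_iff order_refl zero_less_one)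
  have eq: "z' s = z s" "zb' s = zb s" if "s \<in> ?I" for s
    using f1[OF that] neq[OF that] is_z_pair_unique[OF pair[OF that]] by (auto simp: f_def)
  \<comment> \<open>The relations are imposed for \<open>s < 1\<close> only, so equality reaches the
    end point by continuity.\<close>
  have closure: "x 1 = y 1"
    if x: "continuous_on {0..1} x" and y: "continuous_on {0..1} y"
      and exp: "\<And>s. s \<in> ?I \<Longrightarrow> exp (\<i> * x s) = exp (\<i> * y s)"
      and 0: "\<bar>Re (x 0) - Re (y 0)\<bar> < 2 * pi" for x y
  proof -
    have sub: "?I \<subseteq> {0..1}" by auto
    have "x s = y s" if s: "s \<in> ?I" for s
      by (rule exp_eq_imp_eq[OF conn _ continuous_on_subset[OF x sub] continuous_on_subset[OF y sub] exp 0 s])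
        simp_all
    then have diff: "x s - y s = 0" if "s \<in> ?I" for s using that by simp
    have "continuous_on (closure ?I) (\<lambda>s. x s - y s)"
      using x y by (auto intro!: continuous_intros)
    from continuous_constant_on_closure[OF this diff, of 1] have "x 1 - y 1 = 0" by simp
    then show ?thesis by simp
  qed
  have E: "exp (\<i> * chi s) = exp (\<i> * chi' s)" "exp (\<i> * chib s) = exp (\<i> * chib' s)" if "s \<in> ?I" for s
  proof -
    have "rho (z s) = exp (\<i> * chi s)" "rho (zb s) = exp (\<i> * chib s)"
      "rho (z' s) = exp (\<i> * chi' s)" "rho (zb' s) = exp (\<i> * chib' s)"
      using cont that by simp_all
    then show "exp (\<i> * chi s) = exp (\<i> * chi' s)" "exp (\<i> * chib s) = exp (\<i> * chib' s)"
      using eq[OF that] by simp_all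
  qed
  have bounds: "0 \<le> Re (chi 0)" "Re (chi 0) \<le> pi" "- pi \<le> Re (chib 0)" "Re (chib 0) \<le> 0"
    "0 \<le> Re (chi' 0)" "Re (chi' 0) \<le> pi" "- pi \<le> Re (chib' 0)" "Re (chib' 0) \<le> 0"
    and chi: "continuous_on {0..1} chi" "continuous_on {0..1} chi'"
    and chib: "continuous_on {0..1} chib" "continuous_on {0..1} chib'"
    using cont by simp_all
  \<comment> \<open>Both starting values lie in a strip of width \<open>pi\<close>, less than one
    period.\<close>
  have "\<bar>Re (chi 0) - Re (chi' 0)\<bar> < 2 * pi"
    using bounds(1,2,5,6) pi_gt_zero unfolding abs_less_iff by linarith
  from closure[OF chi E(1) this] have "chi 1 = chi' 1" .
  have "\<bar>Re (chib 0) - Re (chib' 0)\<bar> < 2 * pi"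
    using bounds(3,4,7,8) pi_gt_zero unfolding abs_less_iff by linarith
  from closure[OF chib E(2) this] have "chib 1 = chib' 1" .
  with \<open>chi 1 = chi' 1\<close> show ?thesis ..
qed

lemma chi_end_eq:
  assumes "admissible \<gamma> C" "chi_lift \<gamma> z zb chi chib"
  shows "chi_end \<gamma> = chi 1" "chib_end \<gamma> = chib 1"
  unfolding chi_end_def chib_end_def
  using assms chi_lift_unique[OF assms(1)] by (auto intro!: the_equality)

definition euclidean_start :: "complex \<Rightarrow> complex \<Rightarrow> complex \<Rightarrow> bool" where
  "euclidean_start a w wb \<longleftrightarrow> Im a > 0 \<and> 0 \<le> Re w \<and> Re w \<le> pi \<and> - pi \<le> Re wb \<and> Re wb \<le> 0"

lemma full_lift_imp_chi_lift:
  assumes "full_lift \<gamma> z zb chi chib" "euclidean_start (z 0) (chi 0) (chib 0)"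
  shows "chi_lift \<gamma> z zb chi chib"
  using assms unfolding full_lift_def chi_lift_def path_def euclidean_start_def
  by (auto intro: continuous_on_subset)

lemma ex_euclidean_start:
  assumes C: "C \<in> dom_DE - Gamma_set" and reg: "regular C"
  shows "\<exists>a b w wb. is_z_pair C a b \<and> rho a = exp (\<i> * w) \<and> rho b = exp (\<i> * wb) \<and> euclidean_start a w wb"
proof -
  obtain s \<delta> :: real where s: "1 + cr_u C - cr_v C = of_real s" "disc C = of_real \<delta>" "\<delta> \<le> 0"
    using C euclidean_cross_ratios by blast
  have "disc C \<noteq> 0" using C by (intro disc_nonzero) (auto simp: dom_DE_def)
  then have \<delta>: "\<delta> < 0" using s by auto
  \<comment> \<open>The discriminant is negative; this square root puts \<open>a\<close> in the
    upper and \<open>b\<close> in the lower half-plane.\<close>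
  define q where "q = \<i> * of_real (sqrt (- \<delta>))"
  have "q\<^sup>2 = disc C" using \<delta> s by (simp add: q_def power_mult_distrib flip: of_real_power)
  define a b where "a = (1 + cr_u C - cr_v C + q) / 2" and "b = (1 + cr_u C - cr_v C - q) / 2"
  have pair: "is_z_pair C a b" unfolding a_def b_def by (rule is_z_pair_sqrt_disc) fact
  have im: "Im a > 0" "Im b < 0" using \<delta> unfolding a_def b_def s(1) by (simp_all add: q_def)
  have cut: "a \<notin> z_cut" "b \<notin> z_cut" by (rule regular_z_cut[OF reg pair])+
  have "Im (rho a) > 0" "Im (rho b) < 0"
    using sgn_Im_rho[OF cut(1)] sgn_Im_rho[OF cut(2)] im by (simp_all add: sgn_if split: if_splits)
  then have "0 < Im (Ln (rho a)) \<and> Im (Ln (rho a)) < pi" "\<not> (0 \<le> Im (Ln (rho b)) \<and> Im (Ln (rho b)) \<le> pi)"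
    using rho_nonzero[OF cut(1)] rho_nonzero[OF cut(2)] by (simp_all add: Im_Ln_pos_lt Im_Ln_pos_le)
  moreover have "- pi < Im (Ln (rho b))" "Im (Ln (rho b)) \<le> pi"
    using rho_nonzero[OF cut(2)] by (simp_all add: mpi_less_Im_Ln Im_Ln_le_pi)
  ultimately have "euclidean_start a (- \<i> * Ln (rho a)) (- \<i> * Ln (rho b))"
    using im unfolding euclidean_start_def by auto
  moreover have "rho a = exp (\<i> * (- \<i> * Ln (rho a)))" "rho b = exp (\<i> * (- \<i> * Ln (rho b)))"
    using rho_nonzero[OF cut(1)] rho_nonzero[OF cut(2)] by (simp_all add: exp_Ln)
  ultimately show ?thesis using pair by blast
qed

lemma admissible_ex_full_lift:
  fixes C :: "'n::finite conf"
  assumes adm: "admissible \<gamma> C" and reg: "\<And>C :: 'n conf. C \<in> dom_D \<Longrightarrow> regular C" "regular C"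
  shows "\<exists>z zb chi chib. full_lift \<gamma> z zb chi chib \<and> euclidean_start (z 0) (chi 0) (chib 0)"
proof -
  have \<gamma>: "path \<gamma>" "\<gamma> 0 \<in> dom_DE - Gamma_set" "\<And>s. s \<in> {0..<1} \<Longrightarrow> \<gamma> s \<in> dom_D - Gamma_set" "\<gamma> 1 = C"
    using adm by (auto simp: admissible_def)
  have reg': "regular (\<gamma> s)" if "s \<in> {0..1}" for s
    using that \<gamma>(3)[of s] \<gamma>(4) reg by (cases "s = 1") auto
  obtain a b w wb where "is_z_pair (\<gamma> 0) a b" "rho a = exp (\<i> * w)" "rho b = exp (\<i> * wb)"
    "euclidean_start a w wb"
    using ex_euclidean_start[OF \<gamma>(2) reg'] by auto
  moreover have "disc (\<gamma> s) \<noteq> 0" if "s \<in> {0..<1}" for s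
    by (intro disc_nonzero \<gamma>(3) that)
  ultimately show ?thesis
    using ex_full_lift[OF \<gamma>(1) reg'] by metis
qed

section \<open>Construction of admissible paths\<close>

lemma admissible_join:
  assumes "admissible \<gamma> C1" "C1 \<in> dom_D - Gamma_set" "path \<beta>" "path_image \<beta> \<subseteq> dom_D - Gamma_set"
    "\<beta> 0 = C1" "\<beta> 1 = C"
  shows "admissible (\<gamma> +++ \<beta>) C"
proof -
  have mem: "(\<gamma> +++ \<beta>) s \<in> dom_D - Gamma_set" if "s \<in> {0..1}" for s
  proof (cases "s \<le> 1 / 2")
    case True
    have "\<gamma> (2 * s) \<in> dom_D - Gamma_set"
    proof (cases "s = 1 / 2")
      \<comment> \<open>At the junction, admissibility of \<open>\<gamma>\<close> gives only the
        value \<open>C1\<close>, so \<open>C1\<close> itself must avoid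
        \<open>Gamma_set\<close>.\<close>
      case True
      then have "2 * s = 1" by simp
      then show ?thesis using assms(1,2) by (simp add: admissible_def)
    next
      case False
      then have "2 * s \<in> {0..<1}" using that \<open>s \<le> 1 / 2\<close> by auto
      then show ?thesis using assms(1) unfolding admissible_def by blast
    qed
    then show ?thesis using True by (simp add: joinpaths_def)
  next
    case False
    have "\<beta> (2 * s - 1) \<in> path_image \<beta>" using that False by (auto simp: path_image_def)
    then show ?thesis using False assms(4) by (auto simp: joinpaths_def)
  qed
  have "path (\<gamma> +++ \<beta>)"
    using assms by (intro path_join_imp) (auto simp: admissible_def pathstart_def pathfinish_def)
  moreover have "path_image (\<gamma> +++ \<beta>) \<subseteq> closure dom_D"
    using mem closure_subset unfolding path_image_def by blast
  moreover have "(\<gamma> +++ \<beta>) 0 = \<gamma> 0" "(\<gamma> +++ \<beta>) 1 = C"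
    using assms by (simp_all add: joinpaths_def)
  ultimately show ?thesis using mem assms(1) by (auto simp: admissible_def)
qed

lemma ex_admissible:
  fixes C :: "'n::finite conf"
  assumes C: "C \<in> dom_D - Gamma_set"
  shows "\<exists>\<gamma>. admissible \<gamma> C"
proof -
  obtain C0 :: "'n conf" where C0: "C0 \<in> dom_DE - Gamma_set" using ex_dom_DE_diff_Gamma_set by blast
  then have "C0 \<in> dom_D - Gamma_set" by (auto simp: dom_DE_def)
  then obtain \<gamma> where "path \<gamma>" "path_image \<gamma> \<subseteq> dom_D - Gamma_set" "\<gamma> 0 = C0" "\<gamma> 1 = C"
    using path_connected_diff_Gamma_set[OF open_dom_D convex_dom_D order_refl] C
    unfolding path_connected_def pathstart_def pathfinish_def by blast
  moreover from this have "\<gamma> s \<in> dom_D - Gamma_set" if "s \<in> {0..1}" for s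
    using that unfolding path_image_def by blast
  ultimately have "admissible \<gamma> C"
    using C0 closure_subset[of "dom_D :: 'n conf set"] unfolding admissible_def by fastforce
  then show ?thesis by blast
qed

section \<open>The series in chi and chi-bar\<close>

definition abs_conv :: "nat \<Rightarrow> (real \<Rightarrow> nat \<Rightarrow> real) \<Rightarrow> bool" where
  "abs_conv d c \<longleftrightarrow> (\<forall>chi chib. Im chi > 0 \<and> Im chib > 0 \<longrightarrow>
     (\<lambda>p. norm (g_term d c chi chib p)) summable_on ({0..} \<times> {0..}))"

lemma norm_g_term: "norm (g_term d c chi chib (h, hb)) = \<bar>b_coeff d c h hb\<bar> * exp (- (h * Im chi + hb * Im chib))"
  by (simp add: g_term_def norm_mult)

text \<open>The exponents are nonnegative, so the terms shrink as the imaginary parts grow, and the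
  diagonal point \<open>\<i> * \<eta>\<close> yields one majorant for all larger imaginary
  parts.\<close>

lemma norm_g_term_le:
  assumes "\<eta> \<le> Im chi" "\<eta> \<le> Im chib" "p \<in> {0..} \<times> {0..}"
  shows "norm (g_term d c chi chib p) \<le> norm (g_term d c (\<i> * of_real \<eta>) (\<i> * of_real \<eta>) p)"
proof -
  obtain h hb where p: "p = (h, hb)" "h \<ge> 0" "hb \<ge> 0" using assms(3) by auto
  have "h * \<eta> + hb * \<eta> \<le> h * Im chi + hb * Im chib"
    using p assms by (intro add_mono mult_left_mono) auto
  then show ?thesis unfolding p norm_g_term by (intro mult_left_mono) auto
qed

lemma g_term_summable:
  assumes "abs_conv d c" "Im chi > 0" "Im chib > 0"
  shows "g_term d c chi chib summable_on ({0..} \<times> {0..})"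
  using assms unfolding abs_conv_def by (blast intro: abs_summable_summable)

text \<open>Weierstrass test over an uncountable index set: the partial sums form a net over finite
  subsets instead of a sequence.\<close>

lemma g_series_uniform_limit:
  assumes conv: "abs_conv d c" and \<eta>: "\<eta> > 0" "\<And>t. t \<in> T \<Longrightarrow> \<eta> \<le> Im (chi t)" "\<And>t. t \<in> T \<Longrightarrow> \<eta> \<le> Im (chib t)"
  shows "uniform_limit T (\<lambda>A t. \<Sum>p\<in>A. g_term d c (chi t) (chib t) p)
    (\<lambda>t. g_series d c (chi t) (chib t)) (finite_subsets_at_top ({0..} \<times> {0..}))"
  unfolding g_series_def
proof (rule Weierstrass_m_test_general[where M = "\<lambda>p. norm (g_term d c (\<i> * of_real \<eta>) (\<i> * of_real \<eta>) p)"])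
  show "(\<lambda>p. norm (g_term d c (\<i> * of_real \<eta>) (\<i> * of_real \<eta>) p)) summable_on {0..} \<times> {0..}"
    using conv \<eta> unfolding abs_conv_def by simp
qed (use \<eta> in \<open>auto intro: norm_g_term_le\<close>)

lemma g_series_continuous:
  assumes conv: "abs_conv d c"
    and cont: "continuous_on S chi" "continuous_on S chib"
    and pos: "\<And>t. t \<in> S \<Longrightarrow> Im (chi t) > 0" "\<And>t. t \<in> S \<Longrightarrow> Im (chib t) > 0"
  shows "continuous_on S (\<lambda>t. g_series d c (chi t) (chib t))"
proof -
  let ?H = "{x :: complex \<times> complex. Im (fst x) > 0 \<and> Im (snd x) > 0}"
  have "isCont (\<lambda>t. g_series d c (fst t) (snd t)) x" if x: "x \<in> ?H" for x
  proof -
    \<comment> \<open>Half the smaller imaginary part leaves an open neighbourhood of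
      \<open>x\<close> with a common majorant.\<close>
    define \<eta> where "\<eta> = min (Im (fst x)) (Im (snd x)) / 2"
    have \<eta>: "\<eta> > 0" "\<eta> < Im (fst x)" "\<eta> < Im (snd x)" using x by (auto simp: \<eta>_def min_def)
    define T where "T = {t :: complex \<times> complex. \<eta> < Im (fst t) \<and> \<eta> < Im (snd t)}"
    have T: "open T" "x \<in> T"
      using \<eta> unfolding T_def by (auto intro!: open_Collect_conj open_Collect_less continuous_intros)
    have "uniform_limit T (\<lambda>A t. \<Sum>p\<in>A. g_term d c (fst t) (snd t) p)
        (\<lambda>t. g_series d c (fst t) (snd t)) (finite_subsets_at_top ({0..} \<times> {0..}))"
      by (rule g_series_uniform_limit[OF conv \<eta>(1)]) (auto simp: T_def)
    moreover have "continuous_on T (\<lambda>t. \<Sum>p\<in>A. g_term d c (fst t) (snd t) p)" for A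
      unfolding g_term_def case_prod_unfold by (intro continuous_intros)
    ultimately have "continuous_on T (\<lambda>t. g_series d c (fst t) (snd t))"
      by (intro uniform_limit_theorem) auto
    then show ?thesis using T by (simp add: continuous_on_eq_continuous_at)
  qed
  then have "continuous_on ?H (\<lambda>t. g_series d c (fst t) (snd t))"
    by (simp add: continuous_at_imp_continuous_on)
  from continuous_on_compose2[OF this continuous_on_Pair[OF cont]] pos show ?thesis
    by (simp add: image_subset_iff)
qed

lemma g_series_holomorphic:
  assumes conv: "abs_conv d c" and S: "open S"
    and hol: "chi holomorphic_on S" "chib holomorphic_on S"
    and pos: "\<And>t. t \<in> S \<Longrightarrow> Im (chi t) > 0" "\<And>t. t \<in> S \<Longrightarrow> Im (chib t) > 0"
  shows "(\<lambda>t. g_series d c (chi t) (chib t)) holomorphic_on S"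
proof -
  have "(\<lambda>t. g_series d c (chi t) (chib t)) field_differentiable (at x)" if x: "x \<in> S" for x
  proof -
    obtain r where r: "r > 0" "cball x r \<subseteq> S" using S x open_contains_cball by blast
    define f where "f t = min (Im (chi t)) (Im (chib t))" for t
    have hol_cball: "chi holomorphic_on cball x r" "chib holomorphic_on cball x r"
      using hol r by (auto intro: holomorphic_on_subset)
    \<comment> \<open>On a compact disc the imaginary parts have a positive minimum, which serves as
      \<open>\<eta>\<close>.\<close>
    have "continuous_on (cball x r) f"
      unfolding f_def by (intro continuous_intros holomorphic_on_imp_continuous_on hol_cball)
    then obtain y where y: "y \<in> cball x r" "\<And>t. t \<in> cball x r \<Longrightarrow> f y \<le> f t"
      using continuous_attains_inf[of "cball x r" f] r by auto
    have "f y > 0" using pos y(1) r by (auto simp: f_def subset_iff)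
    then have lim: "uniform_limit (cball x r) (\<lambda>A t. \<Sum>p\<in>A. g_term d c (chi t) (chib t) p)
        (\<lambda>t. g_series d c (chi t) (chib t)) (finite_subsets_at_top ({0..} \<times> {0..}))"
      using y by (intro g_series_uniform_limit[OF conv, of "f y"]) (auto simp: f_def)
    have "(\<lambda>t. \<Sum>p\<in>A. g_term d c (chi t) (chib t) p) holomorphic_on cball x r" for A
      unfolding g_term_def case_prod_unfold by (intro holomorphic_intros hol_cball)
    then have "continuous_on (cball x r) (\<lambda>t. \<Sum>p\<in>A. g_term d c (chi t) (chib t) p) \<and>
        (\<lambda>t. \<Sum>p\<in>A. g_term d c (chi t) (chib t) p) holomorphic_on ball x r" for A
      using holomorphic_on_imp_continuous_on holomorphic_on_subset ball_subset_cball by blast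
    from holomorphic_uniform_limit[OF always_eventually[OF allI[OF this]] lim finite_subsets_at_top_neq_bot]
    have "(\<lambda>t. g_series d c (chi t) (chib t)) holomorphic_on ball x r" .
    then show ?thesis
      using r by (metis centre_in_ball holomorphic_on_imp_differentiable_at open_ball)
  qed
  then show ?thesis by (auto simp: holomorphic_on_def intro: field_differentiable_at_within)
qed

text \<open>The Gegenbauer coefficients are palindromic, and replacing \<open>k\<close> by
  \<open>l - k\<close> exchanges \<open>h\<close> and \<open>hb\<close>.\<close>

lemma b_coeff_commute: "b_coeff d c h hb = b_coeff d c hb h"
  unfolding b_coeff_def
proof (rule infsum_reindex_bij_witness[of _ "\<lambda>(l, k). (l, l - k)" "\<lambda>(l, k). (l, l - k)"])
  fix x assume "x \<in> {(l, k). k \<le> l \<and> real l - 2 * real k = h - hb}"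
  then obtain l k where x: "x = (l, k)" "k \<le> l" "real l - 2 * real k = h - hb" by auto
  then show "(case (case x of (l, k) \<Rightarrow> (l, l - k)) of (l, k) \<Rightarrow> c (hb + h) l * gegen_coeff d l k) =
      (case x of (l, k) \<Rightarrow> c (h + hb) l * gegen_coeff d l k)"
    using gegen_coeff_sym[of k l d] by (simp add: add.commute)
qed (auto simp: of_nat_diff)

definition integer_spin :: "nat \<Rightarrow> (real \<Rightarrow> nat \<Rightarrow> real) \<Rightarrow> bool" where
  "integer_spin d c \<longleftrightarrow> (\<forall>h hb. b_coeff d c h hb \<noteq> 0 \<longrightarrow> h - hb \<in> \<int>)"

text \<open>Exchanging the two roots moves the winding number from one argument to the
  other, which the integrality of the spin makes invisible.\<close>

lemma g_series_swap:
  fixes w1 w2 :: complex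
  assumes spin: "integer_spin d c"
  shows "g_series d c (w1 + 2 * pi * of_int n) w2 = g_series d c (w2 + 2 * pi * of_int n) w1"
  unfolding g_series_def
proof (rule infsum_reindex_bij_witness[of _ prod.swap prod.swap])
  fix p :: "real \<times> real" assume "p \<in> {0..} \<times> {0..}"
  obtain h hb where p: "p = (h, hb)" by force
  show "g_term d c (w2 + 2 * pi * of_int n) w1 (prod.swap p) = g_term d c (w1 + 2 * pi * of_int n) w2 p"
  proof (cases "b_coeff d c h hb = 0")
    case True
    then show ?thesis by (simp add: p g_term_def b_coeff_commute[of d c hb h])
  next
    case False
    then obtain m where m: "h = hb + of_int m"
      using spin unfolding integer_spin_def by (metis Ints_cases add.commute diff_add_cancel)
    \<comment> \<open>Since \<open>h - hb = m\<close>, the two exponents differ by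
      \<open>2 * pi * \<i>\<close> times the integer \<open>m * n\<close>.\<close>
    have "\<i> * of_real h * (w1 + 2 * pi * of_int n) + \<i> * of_real hb * w2 =
        \<i> * of_real hb * (w2 + 2 * pi * of_int n) + \<i> * of_real h * w1 + of_int (m * n) * (2 * pi) * \<i>"
      by (simp add: m algebra_simps)
    then have "exp (\<i> * of_real h * (w1 + 2 * pi * of_int n) + \<i> * of_real hb * w2) =
        exp (\<i> * of_real hb * (w2 + 2 * pi * of_int n) + \<i> * of_real h * w1)"
      unfolding exp_eq by (intro exI[of _ "m * n"]) simp
    then show ?thesis by (simp add: p g_term_def b_coeff_commute[of d c hb h])
  qed
qed auto

section \<open>Local continuation across the boundary\<close>

text \<open>Near a boundary configuration the two roots stay in the discs around \<^term>\<open>c1\<close> and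
  \<^term>\<open>c2\<close>.  If these coincide the roots cannot be labelled continuously, but then the value of
  the series does not depend on the labelling.\<close>

locale root_chart =
  fixes d :: nat and c :: "real \<Rightarrow> nat \<Rightarrow> real" and c1 c2 :: complex and r :: real
    and phi1 phi2 :: "complex \<Rightarrow> complex"
  assumes conv: "abs_conv d c" and spin: "integer_spin d c"
    and cut: "ball c1 r \<inter> z_cut = {}" "ball c2 r \<inter> z_cut = {}"
    and sep: "c1 = c2 \<or> ball c1 r \<inter> ball c2 r = {}"
    and phi1: "phi1 holomorphic_on ball c1 r" "\<And>z. z \<in> ball c1 r \<Longrightarrow> rho z = exp (\<i> * phi1 z)"
    and phi2: "phi2 holomorphic_on ball c2 r" "\<And>z. z \<in> ball c2 r \<Longrightarrow> rho z = exp (\<i> * phi2 z)"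
begin

definition H :: "complex \<Rightarrow> complex \<Rightarrow> complex" where
  "H a b = g_series d c (phi1 a) (phi2 b)"

definition chart_pair :: "'n::finite conf \<Rightarrow> complex \<Rightarrow> complex \<Rightarrow> bool" where
  "chart_pair C a b \<longleftrightarrow> is_z_pair C a b \<and> a \<in> ball c1 r \<and> b \<in> ball c2 r"

text \<open>The roots come without an order, so a value is picked among the labellings that fit the
  two discs; \<open>K_eq\<close> shows that the pick is immaterial.\<close>

definition K :: "'n::finite conf \<Rightarrow> complex" where
  "K C = (SOME y. \<exists>a b. chart_pair C a b \<and> y = H a b)"

lemma Im_phi: "a \<in> ball c1 r \<Longrightarrow> Im (phi1 a) > 0" "b \<in> ball c2 r \<Longrightarrow> Im (phi2 b) > 0"
  using cut phi1(2) phi2(2) by (blast intro: Im_pos_if_exp_eq_rho)+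

text \<open>On a common disc \<open>phi1\<close> and \<open>phi2\<close> are logarithms of the same
  function, so they differ by a constant winding and the exchange symmetry of the series
  applies.\<close>

lemma H_swap:
  assumes "c1 = c2" "a \<in> ball c1 r" "b \<in> ball c1 r"
  shows "H a b = H b a"
proof -
  have "\<exists>n::int. \<forall>z\<in>ball c1 r. phi1 z = phi2 z + 2 * pi * of_int n"
    using phi1 phi2 assms(1)
    by (intro exp_eq_imp_const_shift holomorphic_on_imp_continuous_on) auto
  then obtain n :: int where "\<forall>z\<in>ball c1 r. phi1 z = phi2 z + 2 * pi * of_int n" by blast
  then show ?thesis
    using assms g_series_swap[OF spin, of "phi2 a" n "phi2 b"] by (simp add: H_def)
qed

text \<open>Both orders of the roots fit the chart only if the discs meet, hence coincide, and then
  \<open>H\<close> is symmetric.\<close>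

lemma K_eq:
  assumes "chart_pair C a b"
  shows "K C = H a b"
proof -
  have "H a' b' = H a b" if "chart_pair C a' b'" for a' b'
  proof -
    have "(a' = a \<and> b' = b) \<or> (a' = b \<and> b' = a)"
      using assms that is_z_pair_unique unfolding chart_pair_def by blast
    moreover have "H b a = H a b" if "a' = b \<and> b' = a"
      using assms \<open>chart_pair C a' b'\<close> that sep H_swap[of b a] unfolding chart_pair_def by blast
    ultimately show ?thesis by blast
  qed
  moreover have "\<exists>a b. chart_pair C a b \<and> K C = H a b"
    unfolding K_def using assms someI_ex[of "\<lambda>y. \<exists>a b. chart_pair C a b \<and> y = H a b"] by blast
  ultimately show ?thesis by metis
qed

lemma H_continuous: "continuous_on (ball c1 r \<times> ball c2 r) (\<lambda>x. H (fst x) (snd x))"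
  unfolding H_def using Im_phi
  by (intro g_series_continuous[OF conv]
      continuous_on_compose2[OF holomorphic_on_imp_continuous_on[OF phi1(1)]]
      continuous_on_compose2[OF holomorphic_on_imp_continuous_on[OF phi2(1)]])
    (auto intro!: continuous_intros)

text \<open>Continuity passes through the unordered pair of roots by \<open>vieta_near\<close>,
  since \<open>U\<close> may carry no continuous labelling.\<close>

lemma K_continuous:
  fixes U :: "'n::finite conf set"
  assumes U: "open U" and nz: "\<And>C. C \<in> U \<Longrightarrow> xsq 1 3 C \<noteq> 0 \<and> xsq 2 4 C \<noteq> 0"
    and pair: "\<And>C. C \<in> U \<Longrightarrow> \<exists>a b. chart_pair C a b"
  shows "continuous_on U K"
proof -
  have "(K \<longlongrightarrow> K C) (at C)" if C: "C \<in> U" for C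
  proof (rule tendstoI)
    fix e :: real assume e: "e > 0"
    obtain a b where ab: "chart_pair C a b" using pair C by blast
    then have mem: "(a, b) \<in> ball c1 r \<times> ball c2 r" by (simp add: chart_pair_def)
    then have "isCont (\<lambda>x. H (fst x) (snd x)) (a, b)"
      using H_continuous by (simp add: continuous_on_eq_continuous_at open_Times)
    then obtain d1 where d1: "d1 > 0"
      "\<And>x. dist x (a, b) < d1 \<Longrightarrow> dist (H (fst x) (snd x)) (H a b) < e"
      unfolding continuous_at_eps_delta using e by (metis fst_conv snd_conv)
    obtain d2 where d2: "d2 > 0" "ball (a, b) d2 \<subseteq> ball c1 r \<times> ball c2 r"
      using mem openE[OF open_Times[OF open_ball open_ball]] by blast
    \<comment> \<open>Halved because the distance between pairs is bounded by the sum of two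
      errors.\<close>
    define d where "d = min d1 d2 / 2"
    have d: "d > 0" using d1 d2 by (simp add: d_def)
    obtain \<delta> where \<delta>: "\<delta> > 0" "\<And>s p. norm (s - (a + b)) < \<delta> \<Longrightarrow> norm (p - a * b) < \<delta> \<Longrightarrow>
        \<exists>a' b'. a' + b' = s \<and> a' * b' = p \<and> norm (a' - a) < d \<and> norm (b' - b) < d"
      using vieta_near[OF d, of a b] by blast
    have cont: "continuous_on U cr_u" "continuous_on U cr_v" using continuous_on_cr nz by blast+
    then have "continuous_on U (\<lambda>C. 1 + cr_u C - cr_v C)" by (intro continuous_intros)
    then have "((\<lambda>C. 1 + cr_u C - cr_v C) \<longlongrightarrow> 1 + cr_u C - cr_v C) (at C)" "(cr_u \<longlongrightarrow> cr_u C) (at C)"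
      using cont(1) U C by (simp_all only: continuous_on_eq_continuous_at[OF U] continuous_at)
    then have "\<forall>\<^sub>F C' in at C. dist (1 + cr_u C' - cr_v C') (a + b) < \<delta>" "\<forall>\<^sub>F C' in at C. dist (cr_u C') (a * b) < \<delta>"
      using ab \<delta>(1) by (auto simp: chart_pair_def is_z_pair_iff dest: tendstoD)
    then show "\<forall>\<^sub>F C' in at C. dist (K C') (K C) < e"
    proof eventually_elim
      case (elim C')
      then obtain a' b' where a'b': "is_z_pair C' a' b'" "norm (a' - a) < d" "norm (b' - b) < d"
        using \<delta>(2) unfolding is_z_pair_iff dist_norm by blast
      have "dist (a', b') (a, b) \<le> norm (a' - a) + norm (b' - b)"
        using norm_Pair_le[of "a' - a" "b' - b"] by (simp add: dist_norm)
      then have near: "dist (a', b') (a, b) < d1" "dist (a', b') (a, b) < d2"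
        using a'b' by (auto simp: d_def)
      have "(a', b') \<in> ball c1 r \<times> ball c2 r"
        using near(2) d2(2) by (auto simp: dist_commute subset_iff)
      then have "chart_pair C' a' b'" using a'b' by (simp add: chart_pair_def)
      then show ?case using d1(2)[OF near(1)] by (simp add: K_eq K_eq[OF ab])
    qed
  qed
  then show ?thesis
    by (intro continuous_at_imp_continuous_on ballI) (simp only: isCont_def)
qed

text \<open>This ties the chart to lifts along paths: a root cannot pass between disjoint discs, and
  logarithms that agree at the start agree throughout.\<close>

lemma K_lift:
  assumes lift: "full_lift \<beta> z zb chi chib"
    and pair: "\<And>s. s \<in> {0..1} \<Longrightarrow> \<exists>a b. chart_pair (\<beta> s) a b"
    and init: "chart_pair (\<beta> 0) (z 0) (zb 0)" "chi 0 = phi1 (z 0)" "chib 0 = phi2 (zb 0)"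
  shows "K (\<beta> 1) = g_series d c (chi 1) (chib 1)"
proof -
  note L = lift[unfolded full_lift_def path_def]
  have zpair: "is_z_pair (\<beta> s) (z s) (zb s)" if "s \<in> {0..1}" for s
    using L that by simp
  have un: "(z s \<in> ball c1 r \<and> zb s \<in> ball c2 r) \<or> (z s \<in> ball c2 r \<and> zb s \<in> ball c1 r)"
    if s: "s \<in> {0..1}" for s
    using pair[OF s] is_z_pair_unique zpair[OF s] unfolding chart_pair_def by metis
  have mem: "z s \<in> ball c1 r \<and> zb s \<in> ball c2 r" if s: "s \<in> {0..1}" for s
  proof (cases "c1 = c2")
    case True
    then show ?thesis using un[OF s] by auto
  next
    case False
    then have dis: "ball c1 r \<inter> ball c2 r = {}" using sep by blast
    have "connected (z ` {0..1})"
      using L by (intro connected_continuous_image) auto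
    then have "ball c1 r \<inter> ball c2 r \<inter> z ` {0..1} \<noteq> {} \<or> \<not> z ` {0..1} \<subseteq> ball c1 r \<union> ball c2 r \<or>
        ball c1 r \<inter> z ` {0..1} = {} \<or> ball c2 r \<inter> z ` {0..1} = {}"
      unfolding connected_def by (metis open_ball)
    moreover have "z ` {0..1} \<subseteq> ball c1 r \<union> ball c2 r" using un by blast
    moreover have "z 0 \<in> ball c1 r \<inter> z ` {0..1}" using init(1) by (simp add: chart_pair_def)
    ultimately have "ball c2 r \<inter> z ` {0..1} = {}" using dis by blast
    then show ?thesis using un[OF s] s by blast
  qed
  have conn: "connected {0..1::real}" by simp
  have "chi 1 = phi1 (z 1)"
  proof (rule exp_eq_imp_eq[OF conn, of 0 chi "\<lambda>s. phi1 (z s)"])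
    show "continuous_on {0..1} (\<lambda>s. phi1 (z s))"
      using L mem by (intro continuous_on_compose2[OF holomorphic_on_imp_continuous_on[OF phi1(1)]]) auto
    show "exp (\<i> * chi s) = exp (\<i> * phi1 (z s))" if "s \<in> {0..1}" for s
      using L phi1(2)[of "z s"] mem[OF that] that by simp
  qed (use L init in auto)
  moreover have "chib 1 = phi2 (zb 1)"
  proof (rule exp_eq_imp_eq[OF conn, of 0 chib "\<lambda>s. phi2 (zb s)"])
    show "continuous_on {0..1} (\<lambda>s. phi2 (zb s))"
      using L mem by (intro continuous_on_compose2[OF holomorphic_on_imp_continuous_on[OF phi2(1)]]) auto
    show "exp (\<i> * chib s) = exp (\<i> * phi2 (zb s))" if "s \<in> {0..1}" for s
      using L phi2(2)[of "zb s"] mem[OF that] that by simp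
  qed (use L init in auto)
  moreover have "chart_pair (\<beta> 1) (z 1) (zb 1)"
    using zpair[of 1] mem[of 1] by (simp add: chart_pair_def)
  ultimately show ?thesis using K_eq[of "\<beta> 1" "z 1" "zb 1"] by (simp add: H_def)
qed

text \<open>A holomorphic square root of the discriminant labels the roots holomorphically along the
  line, so \<open>K\<close> is locally the series in holomorphic arguments. \<open>q\<close> may
  vanish, which covers lines on which the roots always agree.\<close>

lemma K_line_holomorphic_if_sqrt:
  fixes l :: "complex \<Rightarrow> 'n::finite conf"
  assumes N: "open N" "t0 \<in> N" and pair: "\<And>t. t \<in> N \<Longrightarrow> \<exists>a b. chart_pair (l t) a b"
    and hol: "(\<lambda>t. cr_u (l t)) holomorphic_on N" "(\<lambda>t. cr_v (l t)) holomorphic_on N"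
    and q: "q holomorphic_on N" "\<And>t. t \<in> N \<Longrightarrow> (q t)\<^sup>2 = disc (l t)"
  shows "(\<lambda>t. K (l t)) field_differentiable (at t0)"
proof -
  define f where "f \<sigma> t = (1 + cr_u (l t) - cr_v (l t) + \<sigma> * q t) / 2" for \<sigma> t
  have zp: "is_z_pair (l t) (f \<sigma> t) (f (- \<sigma>) t)" if "t \<in> N" "\<sigma>\<^sup>2 = 1" for \<sigma> t
    using is_z_pair_sqrt_disc[of "\<sigma> * q t" "l t"] that q(2) by (simp add: f_def power_mult_distrib)
  have holf: "f \<sigma> holomorphic_on N" for \<sigma>
    unfolding f_def by (intro holomorphic_intros hol q) auto
  obtain a b where ab: "chart_pair (l t0) a b" using pair N by blast
  then have "(a = f 1 t0 \<and> b = f (- 1) t0) \<or> (a = f (- 1) t0 \<and> b = f 1 t0)"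
    using is_z_pair_unique[of "l t0" "f 1 t0" "f (- 1) t0" a b] zp[of t0 1] N
    unfolding chart_pair_def by simp
  \<comment> \<open>The sign \<open>\<sigma>\<close> decides which root belongs to the first disc at
    \<open>t0\<close>.\<close>
  then obtain \<sigma> where \<sigma>: "\<sigma>\<^sup>2 = 1" "chart_pair (l t0) (f \<sigma> t0) (f (- \<sigma>) t0)"
    using ab that[of 1] that[of "- 1"] by auto
  define M where "M = (N \<inter> f \<sigma> -` ball c1 r) \<inter> (N \<inter> f (- \<sigma>) -` ball c2 r)"
  have "open M" unfolding M_def
    using N(1) holf by (intro open_Int continuous_open_preimage holomorphic_on_imp_continuous_on) auto
  have "t0 \<in> M" using \<sigma> N by (simp add: M_def chart_pair_def)
  have KM: "K (l t) = g_series d c (phi1 (f \<sigma> t)) (phi2 (f (- \<sigma>) t))" if "t \<in> M" for t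
    using K_eq[of "l t" "f \<sigma> t" "f (- \<sigma>) t"] zp[of t \<sigma>] \<sigma>(1) that
    by (simp add: M_def chart_pair_def H_def)
  have "(\<lambda>t. g_series d c (phi1 (f \<sigma> t)) (phi2 (f (- \<sigma>) t))) holomorphic_on M"
  proof (rule g_series_holomorphic[OF conv \<open>open M\<close>])
    have holM: "f \<tau> holomorphic_on M" for \<tau> by (rule holomorphic_on_subset[OF holf]) (auto simp: M_def)
    show "(\<lambda>t. phi1 (f \<sigma> t)) holomorphic_on M"
      by (rule holomorphic_on_compose_gen[OF holM phi1(1), unfolded o_def]) (auto simp: M_def)
    show "(\<lambda>t. phi2 (f (- \<sigma>) t)) holomorphic_on M"
      by (rule holomorphic_on_compose_gen[OF holM phi2(1), unfolded o_def]) (auto simp: M_def)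
  qed (auto simp: M_def intro: Im_phi)
  then have "(\<lambda>t. K (l t)) holomorphic_on M"
    using KM by (simp cong: holomorphic_cong)
  then show ?thesis
    using \<open>open M\<close> \<open>t0 \<in> M\<close> holomorphic_on_imp_differentiable_at by blast
qed

lemma K_field_differentiable:
  fixes U :: "'n::finite conf set"
  assumes U: "open U" "(\<tau>, X) \<in> U" and nz: "\<And>C. C \<in> U \<Longrightarrow> xsq 1 3 C \<noteq> 0 \<and> xsq 2 4 C \<noteq> 0"
    and pair: "\<And>C. C \<in> U \<Longrightarrow> \<exists>a b. chart_pair C a b"
  shows "(\<lambda>t. K (\<tau> + axis k t, X)) field_differentiable (at 0)"
proof -
  define l where "l t = (\<tau> + t *s axis k 1, X)" for t
  have l_eq: "(\<tau> + axis k t, X) = l t" for t by (simp add: l_def vec_eq_iff axis_def)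
  have contl: "continuous_on A l" for A
    unfolding l_def by (intro continuous_intros continuous_on_line)
  have "open (l -` U)" by (intro open_vimage U contl)
  moreover have "0 \<in> l -` U" using U(2) by (simp add: l_def)
  ultimately obtain e where e: "e > 0" "ball 0 e \<subseteq> l -` U" using openE by blast
  let ?B = "ball (0::complex) e"
  have inU: "l t \<in> U" if "t \<in> ?B" for t using e that by blast
  have pairB: "\<exists>a b. chart_pair (l t) a b" if "t \<in> ?B" for t by (rule pair[OF inU[OF that]])
  have holx: "(\<lambda>t. xsq i j (l t)) holomorphic_on ?B" for i j
    unfolding l_def xsq_line by (intro holomorphic_intros)
  have hol: "(\<lambda>t. cr_u (l t)) holomorphic_on ?B" "(\<lambda>t. cr_v (l t)) holomorphic_on ?B"
    unfolding cr_u_def cr_v_def using nz[OF inU] by (intro holomorphic_intros holx; simp)+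
  have hold: "(\<lambda>t. disc (l t)) holomorphic_on ?B"
    unfolding disc_def by (intro holomorphic_intros hol)
  have disc0: "disc (l t) = 0 \<longleftrightarrow> disc_num (l t) = 0" if "t \<in> ?B" for t
    using disc_eq_disc_num[of "l t"] nz[OF inU[OF that]] by simp
  have "(\<lambda>t. K (l t)) field_differentiable (at 0)"
  proof (cases "\<exists>t0. disc_num (l t0) \<noteq> 0")
    case False
    then have "disc (l t) = 0" if "t \<in> ?B" for t using disc0[OF that] by blast
    then show ?thesis
      using e(1) by (intro K_line_holomorphic_if_sqrt[OF open_ball _ pairB hol, where q = "\<lambda>_. 0"]) auto
  next
    case True
    define Z where "Z = {t. disc_num (l t) = 0}"
    have "finite Z" using True finite_disc_num_zeros_on_line unfolding Z_def l_def by blast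
    have "(\<lambda>t. K (l t)) field_differentiable (at t0)" if t0: "t0 \<in> ?B - Z" for t0
    proof -
      have D0: "disc (l t0) \<noteq> 0" using disc0 t0 by (auto simp: Z_def)
      \<comment> \<open>Dividing by the value at \<open>t0\<close> moves the discriminant to 1
        there, away from the branch cut of \<open>csqrt\<close>.\<close>
      define N where "N = ?B \<inter> (\<lambda>t. disc (l t) / disc (l t0)) -` (- \<real>\<^sub>\<le>\<^sub>0)"
      have holN: "(\<lambda>t. disc (l t) / disc (l t0)) holomorphic_on ?B"
        by (intro holomorphic_intros hold) (use D0 in auto)
      have "open N" unfolding N_def
        by (intro continuous_open_preimage holomorphic_on_imp_continuous_on holN) auto
      have sub: "N \<subseteq> ?B" by (auto simp: N_def)
      show ?thesis
      proof (rule K_line_holomorphic_if_sqrt[OF \<open>open N\<close>])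
        show "t0 \<in> N" using t0 D0 by (simp add: N_def)
        show "(\<lambda>t. csqrt (disc (l t0)) * csqrt (disc (l t) / disc (l t0))) holomorphic_on N"
          by (intro holomorphic_intros holomorphic_on_subset[OF holN sub]) (auto simp: N_def)
        show "(csqrt (disc (l t0)) * csqrt (disc (l t) / disc (l t0)))\<^sup>2 = disc (l t)" for t
          using D0 by (simp add: power_mult_distrib)
      qed (use sub pairB hol holomorphic_on_subset in blast)+
    qed
    then have "(\<lambda>t. K (l t)) holomorphic_on ?B - Z"
      by (simp add: holomorphic_on_def field_differentiable_at_within)
    moreover have "continuous_on ?B (\<lambda>t. K (l t))"
      using inU by (intro continuous_on_compose2[OF K_continuous[OF U(1) nz pair] contl]) auto
    \<comment> \<open>Riemann's removable singularity theorem at the finitely many collisions,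
      across which \<open>K\<close> is already continuous.\<close>
    ultimately have "(\<lambda>t. K (l t)) holomorphic_on ?B"
      using no_isolated_singularity[OF _ _ open_ball \<open>finite Z\<close>] by blast
    from holomorphic_on_imp_differentiable_at[OF this open_ball] show ?thesis using e(1) by simp
  qed
  then show ?thesis by (simp only: l_eq)
qed

end

section \<open>The prefactor near a Lorentzian configuration\<close>

text \<open>It makes the limit defining \<open>xsq_pow\<close> unique and lets \<open>dom_D\<close>
  meet every neighbourhood of the configuration.\<close>

lemma dom_DL_islimpt:
  fixes C :: "'n::finite conf"
  assumes "C \<in> dom_DL"
  shows "C islimpt dom_D"
proof -
  \<comment> \<open>Strictly decreasing time shifts lead from imaginary times into the ordered
    domain.\<close>
  define v :: "'n conf" where
    "v = ((\<chi> k. if k = 1 then 3 else if k = 2 then 2 else if k = 3 then 1 else 0), 0)"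
  have "C + s *\<^sub>R v \<in> dom_D" if "s > 0" for s
    using assms that by (simp add: dom_D_def dom_DL_def v_def)
  then have D: "C + (1 / real (Suc n)) *\<^sub>R v \<in> dom_D" for n by simp
  have "(\<lambda>n. C + (1 / real (Suc n)) *\<^sub>R v) \<longlonglongrightarrow> C + 0 *\<^sub>R v"
    by (intro tendsto_intros LIMSEQ_Suc lim_1_over_n)
  moreover have "C \<notin> dom_D" using assms by (simp add: dom_D_def dom_DL_def)
  ultimately show ?thesis
    unfolding islimpt_sequential using D by (intro exI[of _ "\<lambda>n. C + (1 / real (Suc n)) *\<^sub>R v"]) auto
qed

lemma xsq_field_differentiable: "(\<lambda>t. xsq i j (\<tau> + axis k t, X)) field_differentiable (at 0)"
proof -
  have eq: "\<tau> + axis k t = \<tau> + t *s axis k 1" for t by (simp add: vec_eq_iff axis_def)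
  have "(\<lambda>t. xsq i j (\<tau> + t *s axis k 1, X)) holomorphic_on UNIV"
    unfolding xsq_line by (intro holomorphic_intros)
  from holomorphic_on_imp_differentiable_at[OF this open_UNIV UNIV_I] show ?thesis
    by (simp only: eq)
qed

text \<open>\<open>xsq i j CL\<close> may lie on the cut of \<open>Ln\<close>. The ratio to it stays
  in the right half-plane, so the logarithm of the ratio is continuous on \<open>U\<close>. On the
  connected set \<open>U \<inter> dom_D\<close> it differs from the principal logarithm by a
  constant, whose multiple of \<open>2 * pi * \<i>\<close> records the side from which
  \<open>dom_D\<close> approaches the cut.\<close>

lemma xsq_pow_extension:
  fixes U :: "'n::finite conf set"
  assumes CL: "CL \<in> dom_DL" "CL \<in> U" and U: "open U" "convex U" and ij: "i \<noteq> j"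
    and Re: "\<And>C. C \<in> U \<Longrightarrow> Re (xsq i j C / xsq i j CL) > 0"
  shows "\<exists>E. continuous_on U E \<and> (\<forall>C\<in>U. E C \<noteq> 0) \<and> (\<forall>C\<in>U \<inter> dom_D. xsq_pow \<Delta> i j C = E C) \<and>
    xsq_pow \<Delta> i j CL = E CL \<and>
    (\<forall>\<tau> X k. (\<tau>, X) \<in> U \<longrightarrow> (\<lambda>t. E (\<tau> + axis k t, X)) field_differentiable (at 0))"
proof -
  define x0 where "x0 = xsq i j CL"
  have x0: "x0 \<noteq> 0" using CL ij by (simp add: x0_def dom_DL_def)
  have pos: "xsq i j C / x0 \<notin> \<real>\<^sub>\<le>\<^sub>0" if "C \<in> U" for C
    using Re[OF that] by (auto simp: complex_nonpos_Reals_iff x0_def)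
  have contx: "continuous_on U (\<lambda>C. Ln (xsq i j C / x0))"
    using pos x0 by (intro continuous_intros) auto
  define P where "P = U \<inter> (dom_D :: 'n conf set)"
  have "connected P"
    unfolding P_def by (intro convex_connected convex_Int U convex_dom_D)
  have nzD: "xsq i j C \<noteq> 0" "xsq i j C \<notin> \<real>\<^sub>\<le>\<^sub>0" if "C \<in> P" for C
    using that dom_D_xsq[of C i j] dom_D_xsq_nonzero[of C i j] ij by (simp_all add: P_def)
  \<comment> \<open>The factor \<open>- \<i>\<close> brings the logarithms into the form
    \<open>exp (\<i> * f x)\<close> of \<open>exp_eq_imp_const_shift\<close>.\<close>
  have "\<exists>n::int. \<forall>C\<in>P. - \<i> * Ln (xsq i j C) = - \<i> * (Ln (xsq i j C / x0) + Ln x0) + 2 * pi * of_int n"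
  proof (rule exp_eq_imp_const_shift[OF \<open>connected P\<close>])
    show "continuous_on P (\<lambda>C. - \<i> * Ln (xsq i j C))"
      using nzD by (intro continuous_intros) auto
    show "continuous_on P (\<lambda>C. - \<i> * (Ln (xsq i j C / x0) + Ln x0))"
      by (intro continuous_intros continuous_on_subset[OF contx]) (auto simp: P_def)
    show "exp (\<i> * (- \<i> * Ln (xsq i j C))) = exp (\<i> * (- \<i> * (Ln (xsq i j C / x0) + Ln x0)))" if "C \<in> P" for C
      using nzD[OF that] x0 by (simp add: exp_add algebra_simps flip: mult.assoc)
  qed
  then obtain n :: int where
    n: "\<And>C. C \<in> P \<Longrightarrow> - \<i> * Ln (xsq i j C) = - \<i> * (Ln (xsq i j C / x0) + Ln x0) + 2 * pi * of_int n"
    by blast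
  define L where "L C = Ln (xsq i j C / x0) + (Ln x0 + \<i> * (2 * pi * of_int n))" for C :: "'n conf"
  have LP: "L C = Ln (xsq i j C)" if "C \<in> P" for C
  proof -
    have "Ln (xsq i j C) = \<i> * (- \<i> * Ln (xsq i j C))" by simp
    also have "\<dots> = L C" unfolding n[OF that] L_def by (simp add: algebra_simps)
    finally show ?thesis by simp
  qed
  define E where "E C = exp (of_real \<Delta> * L C)" for C
  have contE: "continuous_on U E"
    unfolding E_def L_def by (intro continuous_intros contx)
  have powr: "xsq i j C powr of_real \<Delta> = E C" if "C \<in> P" for C
    using nzD[OF that] LP[OF that] by (simp add: powr_def E_def)
  have "xsq_pow \<Delta> i j C = E C" if "C \<in> P" for C
    using powr[OF that] that by (simp add: xsq_pow_def P_def)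
  moreover have "xsq_pow \<Delta> i j CL = E CL"
  proof -
    have "CL \<notin> dom_D" using CL by (simp add: dom_D_def dom_DL_def)
    \<comment> \<open>At \<open>CL\<close> the power is by definition a limit from
      \<open>dom_D\<close>, where it agrees with the continuous \<open>E\<close>.\<close>
    have "(E \<longlongrightarrow> E CL) (at CL within dom_D)"
      using contE U CL by (metis continuous_on_eq_continuous_at isCont_def tendsto_within_subset subset_UNIV)
    moreover have "\<forall>\<^sub>F C in at CL within dom_D. E C = xsq i j C powr of_real \<Delta>"
      using U CL powr unfolding eventually_at_topological P_def by (metis IntI)
    ultimately have "((\<lambda>C. xsq i j C powr of_real \<Delta>) \<longlongrightarrow> E CL) (at CL within dom_D)"
      by (rule Lim_transform_eventually)
    then have "Lim (at CL within dom_D) (\<lambda>C. xsq i j C powr of_real \<Delta>) = E CL"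
      using dom_DL_islimpt[OF CL(1)] by (intro tendsto_Lim) (simp add: trivial_limit_within)
    then show ?thesis using \<open>CL \<notin> dom_D\<close> by (simp add: xsq_pow_def)
  qed
  moreover have "(\<lambda>t. E (\<tau> + axis k t, X)) field_differentiable (at 0)" if "(\<tau>, X) \<in> U" for \<tau> X k
  proof -
    have "\<tau> + axis k 0 = \<tau>" by (simp add: vec_eq_iff axis_def)
    then have "xsq i j (\<tau> + axis k 0, X) / x0 \<notin> \<real>\<^sub>\<le>\<^sub>0" using pos[OF that] by (simp only: not_False_eq_True)
    moreover have "(\<lambda>t. xsq i j (\<tau> + axis k t, X) / x0) field_differentiable (at 0)"
      using x0 by (intro field_differentiable_divide xsq_field_differentiable) auto
    ultimately have "(Ln \<circ> (\<lambda>t. xsq i j (\<tau> + axis k t, X) / x0)) field_differentiable (at 0)"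
      by (intro field_differentiable_compose field_differentiable_at_Ln) auto
    then have "(\<lambda>t. of_real \<Delta> * L (\<tau> + axis k t, X)) field_differentiable (at 0)"
      unfolding L_def by (intro field_differentiable_mult field_differentiable_add) (auto simp: o_def)
    from field_differentiable_compose[OF this, of exp] show ?thesis
      by (simp add: E_def o_def field_differentiable_within_exp)
  qed
  ultimately show ?thesis using contE unfolding P_def by (intro exI[of _ E]) (auto simp: E_def)
qed

section \<open>Analyticity at Lorentzian configurations\<close>

lemma ex_log_rho:
  assumes "ball c r \<inter> z_cut = {}" "a \<in> ball c r" "rho a = exp (\<i> * w)"
  shows "\<exists>phi. phi holomorphic_on ball c r \<and> (\<forall>z\<in>ball c r. rho z = exp (\<i> * phi z)) \<and> phi a = w"
proof -
  have "rho z \<noteq> 0" if "z \<in> ball c r" for z using that assms(1) rho_nonzero by blast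
  then obtain g where g: "g holomorphic_on ball c r" "\<And>z. z \<in> ball c r \<Longrightarrow> rho z = exp (g z)"
    using contractible_imp_holomorphic_log[OF rho_holomorphic[OF assms(1)] convex_imp_contractible[OF convex_ball]]
    by blast
  have "rho z = exp (\<i> * (w - \<i> * (g z - g a)))" if "z \<in> ball c r" for z
  proof -
    have "\<i> * (w - \<i> * (g z - g a)) = \<i> * w + (g z - g a)" by (simp add: algebra_simps)
    then have "exp (\<i> * (w - \<i> * (g z - g a))) = exp (\<i> * w) * exp (g z) / exp (g a)"
      by (simp only: exp_add exp_diff) simp
    then show ?thesis using g(2)[OF assms(2)] g(2)[OF that] assms(3) by simp
  qed
  moreover have "(\<lambda>z. w - \<i> * (g z - g a)) holomorphic_on ball c r" by (intro holomorphic_intros g)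
  ultimately show ?thesis by (intro exI[of _ "\<lambda>z. w - \<i> * (g z - g a)"]) simp
qed

lemma analytic_in_timesI:
  fixes F :: "'n::finite conf \<Rightarrow> complex"
  assumes U: "open U" and cont: "continuous_on U F"
    and hol: "\<And>\<tau> X k. (\<tau>, X) \<in> U \<Longrightarrow> (\<lambda>t. F (\<tau> + axis k t, X)) field_differentiable (at 0)"
  shows "analytic_in_times U F"
proof -
  have "\<exists>D. ((\<lambda>\<tau>'. F (\<tau>', X)) has_derivative D) (at \<tau>) \<and> (\<forall>a w. D (a *s w) = a * D w)"
    if "(\<tau>, X) \<in> U" for \<tau> X
  proof (rule osgood)
    show "open ((\<lambda>\<tau>'. (\<tau>', X)) -` U)" by (intro open_vimage U continuous_intros)
    show "continuous_on ((\<lambda>\<tau>'. (\<tau>', X)) -` U) (\<lambda>\<tau>'. F (\<tau>', X))"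
      by (intro continuous_on_compose2[OF cont]) (auto intro!: continuous_intros)
  qed (use that hol in auto)
  then show ?thesis using cont by (auto simp: analytic_in_times_def)
qed

lemma separating_balls:
  fixes a b :: complex
  assumes "a \<notin> z_cut" "b \<notin> z_cut"
  shows "\<exists>r>0. ball a r \<inter> z_cut = {} \<and> ball b r \<inter> z_cut = {} \<and> (a = b \<or> ball a r \<inter> ball b r = {})"
proof -
  have op: "open (- z_cut)" using closed_z_cut by (simp only: open_Compl)
  obtain r1 where r1: "r1 > 0" "ball a r1 \<subseteq> - z_cut"
    using openE[OF op, of a] assms(1) by (metis ComplI)
  obtain r2 where r2: "r2 > 0" "ball b r2 \<subseteq> - z_cut"
    using openE[OF op, of b] assms(2) by (metis ComplI)
  \<comment> \<open>Half the distance keeps the discs around distinct roots disjoint.\<close>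
  define r where "r = (if a = b then min r1 r2 else min (min r1 r2) (dist a b / 2))"
  have r: "r > 0" "r \<le> r1" "r \<le> r2" "a = b \<or> 2 * r \<le> dist a b"
    using r1(1) r2(1) by (auto simp: r_def)
  have "ball a r \<inter> ball b r = {}" if "a \<noteq> b"
  proof -
    have "2 * r \<le> dist a b" using r(4) that by blast
    then show ?thesis by (intro disjoint_ballI) simp
  qed
  moreover have "ball a r \<subseteq> - z_cut" "ball b r \<subseteq> - z_cut"
    using r1(2) r2(2) subset_ball[OF r(2), of a] subset_ball[OF r(3), of b] by (meson order_trans)+
  ultimately show ?thesis using r(1) by (intro exI[of _ r]) (simp only: disjoint_eq_subset_Compl; blast)
qed

text \<open>The sum and the product of the roots are continuous at \<open>CL\<close>, which keeps
  the roots in their discs; the positive real parts keep the powers in the prefactor on one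
  branch.\<close>

lemma root_neighbourhood:
  fixes CL :: "'n::finite conf"
  assumes CL: "regular CL" and pair: "is_z_pair CL z zb" and r: "r > 0"
  shows "\<exists>\<delta>>0. \<forall>C\<in>ball CL \<delta>. xsq 1 3 C \<noteq> 0 \<and> xsq 2 4 C \<noteq> 0 \<and>
    Re (xsq 1 2 C / xsq 1 2 CL) > 0 \<and> Re (xsq 3 4 C / xsq 3 4 CL) > 0 \<and>
    (\<exists>a b. is_z_pair C a b \<and> a \<in> ball z r \<and> b \<in> ball zb r)"
proof -
  have nz: "xsq 1 3 CL \<noteq> 0" "xsq 2 4 CL \<noteq> 0" "xsq 1 2 CL \<noteq> 0" "xsq 3 4 CL \<noteq> 0"
    using CL by (simp_all add: regular_def)
  have contx: "(xsq i j \<longlongrightarrow> xsq i j CL) (nhds CL)" for i j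
  proof -
    have "\<forall>C\<in>UNIV. isCont (xsq i j) (C :: 'n conf)"
      using continuous_on_xsq by (simp only: continuous_on_eq_continuous_at[OF open_UNIV, symmetric])
    then have "isCont (xsq i j) CL" by blast
    then show ?thesis by (simp add: isCont_def tendsto_nhds_iff)
  qed
  obtain d where d: "d > 0" "\<And>s p. norm (s - (z + zb)) < d \<Longrightarrow> norm (p - z * zb) < d \<Longrightarrow>
      \<exists>a b. a + b = s \<and> a * b = p \<and> norm (a - z) < r \<and> norm (b - zb) < r"
    using vieta_near[OF r, of z zb] by blast
  have u: "(cr_u \<longlongrightarrow> cr_u CL) (nhds CL)" and v: "(cr_v \<longlongrightarrow> cr_v CL) (nhds CL)"
    unfolding cr_u_def cr_v_def using nz by (auto intro!: tendsto_intros contx)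
  then have "((\<lambda>C. 1 + cr_u C - cr_v C) \<longlongrightarrow> 1 + cr_u CL - cr_v CL) (nhds CL)"
    by (intro tendsto_intros)
  then have "\<forall>\<^sub>F C in nhds CL. dist (1 + cr_u C - cr_v C) (z + zb) < d" "\<forall>\<^sub>F C in nhds CL. dist (cr_u C) (z * zb) < d"
    using pair u d(1) by (auto simp: is_z_pair_iff dest: tendstoD)
  moreover have "\<forall>\<^sub>F C in nhds CL. xsq 1 3 C \<noteq> 0" "\<forall>\<^sub>F C in nhds CL. xsq 2 4 C \<noteq> 0"
    using contx nz by (auto intro: tendsto_imp_eventually_ne)
  moreover have "\<forall>\<^sub>F C in nhds CL. Re (xsq i j C / xsq i j CL) > 0" if "xsq i j CL \<noteq> 0" for i j
  proof (rule order_tendstoD)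
    show "((\<lambda>C. Re (xsq i j C / xsq i j CL)) \<longlongrightarrow> Re (xsq i j CL / xsq i j CL)) (nhds CL)"
      using that by (intro tendsto_intros contx)
  qed (use that in simp)
  ultimately have "\<forall>\<^sub>F C in nhds CL. xsq 1 3 C \<noteq> 0 \<and> xsq 2 4 C \<noteq> 0 \<and>
    Re (xsq 1 2 C / xsq 1 2 CL) > 0 \<and> Re (xsq 3 4 C / xsq 3 4 CL) > 0 \<and>
    dist (1 + cr_u C - cr_v C) (z + zb) < d \<and> dist (cr_u C) (z * zb) < d"
    using nz by (auto simp: eventually_conj_iff)
  then have "\<forall>\<^sub>F C in nhds CL. xsq 1 3 C \<noteq> 0 \<and> xsq 2 4 C \<noteq> 0 \<and>
    Re (xsq 1 2 C / xsq 1 2 CL) > 0 \<and> Re (xsq 3 4 C / xsq 3 4 CL) > 0 \<and>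
    (\<exists>a b. is_z_pair C a b \<and> a \<in> ball z r \<and> b \<in> ball zb r)"
  proof eventually_elim
    case (elim C)
    then obtain a b where "is_z_pair C a b" "norm (a - z) < r" "norm (b - zb) < r"
      using d(2) unfolding is_z_pair_iff dist_norm by blast
    then show ?case using elim by (auto simp: dist_norm norm_minus_commute)
  qed
  then show ?thesis unfolding eventually_nhds_metric by (auto simp: dist_commute)
qed

section \<open>Calibration of the extension along paths\<close>

lemma full_lift_end:
  assumes "admissible \<gamma> C" "full_lift \<gamma> z zb chi chib" "euclidean_start (z 0) (chi 0) (chib 0)"
  shows "chi_end \<gamma> = chi 1" "chib_end \<gamma> = chib 1"
  using chi_end_eq[OF assms(1) full_lift_imp_chi_lift[OF assms(2,3)]] .

lemma full_lift_end_scale: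
  assumes adm: "admissible \<gamma> C" and lift: "full_lift \<gamma> z zb chi chib"
    and start: "euclidean_start (z 0) (chi 0) (chib 0)" and s: "0 < s" "s < 1"
  shows "chi_end (\<lambda>t. \<gamma> (s * t)) = chi s" "chib_end (\<lambda>t. \<gamma> (s * t)) = chib s"
proof -
  have "full_lift (\<lambda>t. \<gamma> (s * t)) (\<lambda>t. z (s * t)) (\<lambda>t. zb (s * t)) (\<lambda>t. chi (s * t)) (\<lambda>t. chib (s * t))"
    using s by (intro full_lift_scale[OF lift]) auto
  from full_lift_end[OF admissible_scale[OF adm s] this] start
  show "chi_end (\<lambda>t. \<gamma> (s * t)) = chi s" "chib_end (\<lambda>t. \<gamma> (s * t)) = chib s" by simp_all
qed

text \<open>The chart is fixed at \<open>C1\<close>; at any other collision-free point of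
  \<open>U \<inter> dom_D\<close> it agrees with \<open>G\<close> by continuing the lift inside that
  set, and collisions follow by continuity. \<open>E\<close> is exported because the prefactor at
  \<open>CL\<close> is itself a limit from the domain.\<close>

lemma local_continuation:
  fixes G :: "'n::finite conf \<Rightarrow> complex" and CL :: "'n conf"
  assumes conv: "abs_conv d c" and spin: "integer_spin d c"
    and G: "analytic_in_times dom_D G"
      "\<And>C \<gamma>. C \<in> dom_D \<Longrightarrow> admissible \<gamma> C \<Longrightarrow> G C = g_series d c (chi_end \<gamma>) (chib_end \<gamma>) / prefactor \<Delta> C"
    and reg: "\<And>C :: 'n conf. C \<in> dom_D \<Longrightarrow> regular C"
    and CL: "CL \<in> dom_DL" "regular CL"
  shows "\<exists>U F E. open U \<and> CL \<in> U \<and> analytic_in_times U F \<and> continuous_on U E \<and>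
    (\<forall>C\<in>U. E C \<noteq> 0) \<and> (\<forall>C\<in>U \<inter> dom_D. F C = G C) \<and>
    (\<forall>C\<in>U \<inter> dom_D. prefactor \<Delta> C = E C) \<and> prefactor \<Delta> CL = E CL"
proof -
  obtain z0 zb0 where pair0: "is_z_pair CL z0 zb0" using ex_is_z_pair by blast
  obtain r where r: "r > 0" "ball z0 r \<inter> z_cut = {}" "ball zb0 r \<inter> z_cut = {}"
      "z0 = zb0 \<or> ball z0 r \<inter> ball zb0 r = {}"
    using separating_balls[OF regular_z_cut[OF CL(2) pair0]] by blast
  obtain \<delta> where \<delta>: "\<delta> > 0" "\<And>C. C \<in> ball CL \<delta> \<Longrightarrow> xsq 1 3 C \<noteq> 0 \<and> xsq 2 4 C \<noteq> 0"
      "\<And>C. C \<in> ball CL \<delta> \<Longrightarrow> Re (xsq 1 2 C / xsq 1 2 CL) > 0"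
      "\<And>C. C \<in> ball CL \<delta> \<Longrightarrow> Re (xsq 3 4 C / xsq 3 4 CL) > 0"
      "\<And>C. C \<in> ball CL \<delta> \<Longrightarrow> \<exists>a b. is_z_pair C a b \<and> a \<in> ball z0 r \<and> b \<in> ball zb0 r"
    using root_neighbourhood[OF CL(2) pair0 r(1)] by blast
  define U where "U = ball CL \<delta>"
  have U: "open U" "convex U" "CL \<in> U" using \<delta>(1) by (simp_all add: U_def)
  note nz = \<delta>(2)[folded U_def]
  let ?V = "U \<inter> dom_D"
  have V: "open ?V" "convex ?V" "?V \<subseteq> dom_D"
    by (intro open_Int convex_Int U open_dom_D convex_dom_D Int_lower2)+
  obtain E12 where E12: "continuous_on U E12" "\<forall>C\<in>U. E12 C \<noteq> 0" "\<forall>C\<in>?V. xsq_pow \<Delta> 1 2 C = E12 C"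
      "xsq_pow \<Delta> 1 2 CL = E12 CL"
      "\<And>\<tau> X k. (\<tau>, X) \<in> U \<Longrightarrow> (\<lambda>t. E12 (\<tau> + axis k t, X)) field_differentiable (at 0)"
    using xsq_pow_extension[OF CL(1) U(3,1,2) _ \<delta>(3)[folded U_def], where \<Delta> = \<Delta>] by auto
  obtain E34 where E34: "continuous_on U E34" "\<forall>C\<in>U. E34 C \<noteq> 0" "\<forall>C\<in>?V. xsq_pow \<Delta> 3 4 C = E34 C"
      "xsq_pow \<Delta> 3 4 CL = E34 CL"
      "\<And>\<tau> X k. (\<tau>, X) \<in> U \<Longrightarrow> (\<lambda>t. E34 (\<tau> + axis k t, X)) field_differentiable (at 0)"
    using xsq_pow_extension[OF CL(1) U(3,1,2) _ \<delta>(4)[folded U_def], where \<Delta> = \<Delta>] by auto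
  define E where "E C = E12 C * E34 C" for C
  have E: "continuous_on U E" "\<forall>C\<in>U. E C \<noteq> 0" "\<forall>C\<in>?V. prefactor \<Delta> C = E C" "prefactor \<Delta> CL = E CL"
    using E12 E34 by (auto simp: E_def prefactor_def intro!: continuous_intros)
  have "?V \<noteq> {}"
    using dom_DL_islimpt[OF CL(1)] U unfolding islimpt_def by blast
  then obtain C1 where C1: "C1 \<in> ?V" "C1 \<notin> Gamma_set"
    using ex_disc_num_nonzero[OF V(1)] mem_Gamma_set_iff_num by blast
  obtain \<gamma> where \<gamma>: "admissible \<gamma> C1" using ex_admissible[of C1] C1 by blast
  obtain z zb chi chib where lift: "full_lift \<gamma> z zb chi chib" "euclidean_start (z 0) (chi 0) (chib 0)"
    using admissible_ex_full_lift[OF \<gamma> reg] C1 reg by blast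
  have \<gamma>1: "\<gamma> 1 = C1" using \<gamma> by (simp add: admissible_def)
  have end1: "is_z_pair C1 (z 1) (zb 1)" "rho (z 1) = exp (\<i> * chi 1)" "rho (zb 1) = exp (\<i> * chib 1)"
    using lift(1) \<gamma>1 by (auto simp: full_lift_def)
  \<comment> \<open>The lift decides which root is called \<open>z\<close>, so the discs are named
    after the lift.\<close>
  have "(z 1 \<in> ball z0 r \<and> zb 1 \<in> ball zb0 r) \<or> (zb 1 \<in> ball z0 r \<and> z 1 \<in> ball zb0 r)"
    using \<delta>(5)[folded U_def, of C1] C1 is_z_pair_unique[OF _ end1(1)] by blast
  then obtain c1 c2 where c: "z 1 \<in> ball c1 r" "zb 1 \<in> ball c2 r" "(c1 = z0 \<and> c2 = zb0) \<or> (c1 = zb0 \<and> c2 = z0)"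
    by blast
  then have cut: "ball c1 r \<inter> z_cut = {}" "ball c2 r \<inter> z_cut = {}" "c1 = c2 \<or> ball c1 r \<inter> ball c2 r = {}"
    using r by (auto simp: Int_commute)
  \<comment> \<open>The logarithm is normalised to the value reached along \<open>\<gamma>\<close>,
    winding included.\<close>
  obtain phi1 where log1: "phi1 holomorphic_on ball c1 r" "\<forall>z\<in>ball c1 r. rho z = exp (\<i> * phi1 z)" "phi1 (z 1) = chi 1"
    using ex_log_rho[OF cut(1) c(1) end1(2)] by blast
  obtain phi2 where log2: "phi2 holomorphic_on ball c2 r" "\<forall>z\<in>ball c2 r. rho z = exp (\<i> * phi2 z)" "phi2 (zb 1) = chib 1"
    using ex_log_rho[OF cut(2) c(2) end1(3)] by blast
  interpret root_chart d c c1 c2 r phi1 phi2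
    using conv spin cut log1 log2 by unfold_locales auto
  have pair: "\<exists>a b. chart_pair C a b" if "C \<in> U" for C
    using \<delta>(5)[folded U_def, OF that] c(3) is_z_pair_commute unfolding chart_pair_def by metis
  define F where "F C = K C / E C" for C :: "'n conf"
  have contF: "continuous_on U F"
    unfolding F_def using E by (intro continuous_intros K_continuous[OF U(1) nz pair]) auto
  have "analytic_in_times U F"
  proof (rule analytic_in_timesI[OF U(1) contF])
    fix \<tau> X k assume C: "(\<tau>, X) \<in> U"
    have "\<tau> + axis k 0 = \<tau>" by (simp add: vec_eq_iff axis_def)
    then have "(\<tau> + axis k 0, X) \<in> U" using C by (simp only:)
    then have "E (\<tau> + axis k 0, X) \<noteq> 0" using E(2) by blast
    then show "(\<lambda>t. F (\<tau> + axis k t, X)) field_differentiable (at 0)"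
      unfolding F_def E_def
      by (intro field_differentiable_divide field_differentiable_mult E12(5) E34(5) C
          K_field_differentiable[OF U(1) C nz pair])
  qed
  moreover have "F C = G C" if C: "C \<in> ?V" for C
  proof (rule ccontr)
    assume neq: "F C \<noteq> G C"
    \<comment> \<open>The set where \<open>F\<close> and \<open>G\<close> differ is open, so it
      would contain a collision-free point.\<close>
    have "continuous_on ?V (\<lambda>C. F C - G C)"
      using G(1) contF unfolding analytic_in_times_def
      by (intro continuous_on_diff) (auto intro: continuous_on_subset)
    then have "open (?V \<inter> (\<lambda>C. F C - G C) -` (- {0}))"
      by (intro continuous_open_preimage V) auto
    moreover have "C \<in> ?V \<inter> (\<lambda>C. F C - G C) -` (- {0})" using C neq by simp
    ultimately obtain C' where "C' \<in> ?V \<inter> (\<lambda>C. F C - G C) -` (- {0})" "disc_num C' \<noteq> 0"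
      using ex_disc_num_nonzero by blast
    then have C': "C' \<in> ?V" "F C' \<noteq> G C'" "disc_num C' \<noteq> 0" by simp_all
    then have "C' \<in> ?V - Gamma_set" by (simp add: mem_Gamma_set_iff_num)
    then obtain \<beta> where \<beta>: "path \<beta>" "path_image \<beta> \<subseteq> ?V - Gamma_set" "\<beta> 0 = C1" "\<beta> 1 = C'"
      using path_connected_diff_Gamma_set[OF V] C1
      unfolding path_connected_def pathstart_def pathfinish_def by blast
    have \<beta>mem: "\<beta> s \<in> ?V - Gamma_set" if "s \<in> {0..1}" for s
      using \<beta>(2) that unfolding path_image_def by blast
    have "regular (\<beta> s)" if "s \<in> {0..1}" for s using reg \<beta>mem[OF that] by blast
    moreover have "disc (\<beta> s) \<noteq> 0" if "s \<in> {0..<1}" for s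
      using \<beta>mem[of s] that by (intro disc_nonzero) auto
    ultimately obtain z' zb' chi' chib' where lift': "full_lift \<beta> z' zb' chi' chib'"
        "z' 0 = z 1" "zb' 0 = zb 1" "chi' 0 = chi 1" "chib' 0 = chib 1"
      using ex_full_lift[OF \<beta>(1), of "z 1" "zb 1" "chi 1" "chib 1"] end1 \<beta>(3) by metis
    have "K (\<beta> 1) = g_series d c (chi' 1) (chib' 1)"
    proof (rule K_lift[OF lift'(1)])
      show "\<exists>a b. chart_pair (\<beta> s) a b" if "s \<in> {0..1}" for s using pair \<beta>mem[OF that] by blast
      show "chart_pair (\<beta> 0) (z' 0) (zb' 0)"
        using end1 c by (simp add: lift' \<beta> chart_pair_def)
    qed (simp_all only: lift' log1(3) log2(3))
    \<comment> \<open>The joined path is admissible for \<open>C'\<close>, and its end values are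
      those to which \<open>K\<close> was followed along \<open>\<beta>\<close>.\<close>
    moreover have adm: "admissible (\<gamma> +++ \<beta>) C'"
      using \<beta> C1 V(3) by (intro admissible_join[OF \<gamma>]) auto
    have "full_lift (\<gamma> +++ \<beta>) (z +++ z') (zb +++ zb') (chi +++ chi') (chib +++ chib')"
      by (rule full_lift_join[OF lift(1) lift'(1)]) (simp_all add: lift')
    from full_lift_end[OF adm this] lift(2)
    have "chi_end (\<gamma> +++ \<beta>) = chi' 1" "chib_end (\<gamma> +++ \<beta>) = chib' 1"
      by (simp_all add: joinpaths_def)
    ultimately have "G C' = F C'"
      using G(2)[OF _ adm] C'(1) E(3) \<beta>(4) by (simp add: F_def)
    then show False using C'(2) by simp
  qed
  ultimately show ?thesis using U E by blast
qed

theorem theorem4p1: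
  fixes G GE :: "'n::finite conf \<Rightarrow> complex"
    and g :: "complex \<Rightarrow> complex \<Rightarrow> complex"
    and c :: "real \<Rightarrow> nat \<Rightarrow> real"
    and \<Delta> :: real
    and CL :: "'n conf"
  assumes euclidean: "euclidean_four_point \<Delta> c g GE"
    and continued: "continued_four_point \<Delta> c GE G"
    and known_fact: "\<forall>C\<in>(dom_D :: 'n conf set). \<forall>z zb. is_z_pair C z zb \<longrightarrow>
          z \<notin> {0} \<union> complex_of_real ` {1..} \<and> zb \<notin> {0} \<union> complex_of_real ` {1..}"
    and lorentzian: "CL \<in> dom_DL"
    and no_cut: "\<forall>z zb. is_z_pair CL z zb \<longrightarrow>
          z \<notin> complex_of_real ` {1<..} \<and> zb \<notin> complex_of_real ` {1<..}"
  shows "analytic_at_boundary G CL \<and>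
    (\<forall>\<gamma>. admissible \<gamma> CL \<longrightarrow>
       Im (chi_end \<gamma>) > 0 \<and> Im (chib_end \<gamma>) > 0 \<and>
       g_term (CARD('n) + 1) c (chi_end \<gamma>) (chib_end \<gamma>) summable_on ({0..} \<times> {0..}) \<and>
       has_lorentzian_value G CL
         (g_series (CARD('n) + 1) c (chi_end \<gamma>) (chib_end \<gamma>) / prefactor \<Delta> CL))"
proof -
  define d where "d = CARD('n) + 1"
  have conv: "abs_conv d c" and spin: "integer_spin d c"
    using euclidean unfolding euclidean_four_point_def Let_def abs_conv_def integer_spin_def d_def by blast+
  have Gan: "analytic_in_times dom_D G" and Gval: "\<And>C \<gamma>. C \<in> dom_D \<Longrightarrow> admissible \<gamma> C \<Longrightarrow>
      G C = g_series d c (chi_end \<gamma>) (chib_end \<gamma>) / prefactor \<Delta> C"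
    using continued unfolding continued_four_point_def d_def by blast+
  have reg: "regular C" if "C \<in> dom_D" for C :: "'n conf"
    using known_fact that dom_D_xsq_nonzero unfolding regular_def by blast
  have regL: "regular CL"
    unfolding regular_def
  proof (intro conjI allI impI)
    show "xsq i j CL \<noteq> 0" if "i \<noteq> j" for i j using lorentzian that by (simp add: dom_DL_def)
    fix z zb assume p: "is_z_pair CL z zb"
    \<comment> \<open>A root 0 would force \<open>cr_u CL = 0\<close> and a root 1 would force
      \<open>cr_v CL = 0\<close>, so \<open>no_cut\<close> extends to the closed ray and to
      0.\<close>
    have "cr_u CL \<noteq> 0" "cr_v CL \<noteq> 0"
      using lorentzian by (auto simp: dom_DL_def cr_u_def cr_v_def)
    then have "z \<noteq> 0" "zb \<noteq> 0" "z \<noteq> 1" "zb \<noteq> 1" using p by (auto simp: is_z_pair_def)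
    moreover have "z \<notin> complex_of_real ` {1<..}" "zb \<notin> complex_of_real ` {1<..}"
      using no_cut p by blast+
    moreover have "{1..} = insert 1 {1::real<..}" by auto
    ultimately show "z \<notin> z_cut" "zb \<notin> z_cut" by auto
  qed
  obtain U F E where U: "open U" "CL \<in> U" and F: "analytic_in_times U F" "\<forall>C\<in>U \<inter> dom_D. F C = G C"
    and E: "continuous_on U E" "\<forall>C\<in>U. E C \<noteq> 0" "\<forall>C\<in>U \<inter> dom_D. prefactor \<Delta> C = E C" "prefactor \<Delta> CL = E CL"
    using local_continuation[OF conv spin Gan Gval reg lorentzian regL] by blast
  have contF: "continuous_on U F" using F by (simp add: analytic_in_times_def)
  \<comment> \<open>The ordered shifts lie in \<open>dom_D\<close>, where \<open>F\<close> equals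
    \<open>G\<close>, and \<open>F\<close> is continuous at \<open>CL\<close>.\<close>
  have value_F: "has_lorentzian_value G CL (F CL)"
    unfolding has_lorentzian_value_def
  proof (rule Lim_transform_eventually)
    let ?A = "{e :: real ^ 4. e $ 1 > e $ 2 \<and> e $ 2 > e $ 3 \<and> e $ 3 > e $ 4}"
    define s where "s e = ((\<chi> k. of_real (e $ k) + fst CL $ k), snd CL)" for e :: "real ^ 4"
    have s0: "s 0 = CL" by (simp add: s_def prod_eq_iff vec_eq_iff)
    have "continuous_on UNIV s"
      unfolding s_def by (intro continuous_intros continuous_on_vec_lambda)
    then have "(s \<longlongrightarrow> s 0) (at 0)" unfolding continuous_on_def by blast
    then have lim: "(s \<longlongrightarrow> CL) (at 0 within ?A)"
      unfolding s0 by (rule tendsto_within_subset) simp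
    have "isCont F CL" using contF U by (simp add: continuous_on_eq_continuous_at)
    then show "((\<lambda>e. F ((\<chi> k. of_real (e $ k) + fst CL $ k), snd CL)) \<longlongrightarrow> F CL) (at 0 within ?A)"
      using isCont_tendsto_compose[OF _ lim] by (simp add: s_def)
    have "\<forall>\<^sub>F e in at 0 within ?A. s e \<in> U" using topological_tendstoD[OF lim U] .
    moreover have "\<forall>\<^sub>F e in at 0 within ?A. e \<in> ?A" by (simp add: eventually_at_filter)
    ultimately show "\<forall>\<^sub>F e in at 0 within ?A. F ((\<chi> k. of_real (e $ k) + fst CL $ k), snd CL) =
        G ((\<chi> k. of_real (e $ k) + fst CL $ k), snd CL)"
    proof eventually_elim
      case (elim e)
      have "s e \<in> dom_D" using elim(2) lorentzian by (simp add: s_def dom_D_def dom_DL_def)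
      then show ?case using F(2) elim(1) by (simp add: s_def)
    qed
  qed
  have "analytic_at_boundary G CL"
    unfolding analytic_at_boundary_def using U F by blast
  moreover have "Im (chi_end \<gamma>) > 0 \<and> Im (chib_end \<gamma>) > 0 \<and>
      F CL = g_series d c (chi_end \<gamma>) (chib_end \<gamma>) / prefactor \<Delta> CL" if adm: "admissible \<gamma> CL" for \<gamma>
  proof -
    have \<gamma>: "path \<gamma>" "\<gamma> 1 = CL" "\<And>s. s \<in> {0..<1} \<Longrightarrow> \<gamma> s \<in> dom_D - Gamma_set"
      using adm by (simp_all add: admissible_def)
    obtain z zb chi chib where lift: "full_lift \<gamma> z zb chi chib" "euclidean_start (z 0) (chi 0) (chib 0)"
      using admissible_ex_full_lift[OF adm reg regL] by blast
    have "regular (\<gamma> s)" if "s \<in> {0..1}" for s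
      using that \<gamma>(2) \<gamma>(3)[of s] reg regL by (cases "s = 1") auto
    then have Im: "Im (chi s) > 0" "Im (chib s) > 0" if "s \<in> {0..1}" for s
      using lift(1) that regular_z_cut Im_pos_if_exp_eq_rho unfolding full_lift_def by metis+
    have cont: "continuous_on {0..1} (\<lambda>s. g_series d c (chi s) (chib s))"
      using lift(1) Im unfolding full_lift_def path_def by (intro g_series_continuous[OF conv]) auto
    have "(\<gamma> \<longlongrightarrow> CL) (at 1 within {0..1})"
      using \<gamma>(1,2) by (auto simp: path_def continuous_on_def)
    then have "\<forall>\<^sub>F s in at 1 within {0..1}. \<gamma> s \<in> U" using U by (rule topological_tendstoD)
    then obtain \<delta> where \<delta>: "\<delta> > 0" "\<And>s. s \<in> {0..1} \<Longrightarrow> s \<noteq> 1 \<Longrightarrow> dist s 1 < \<delta> \<Longrightarrow> \<gamma> s \<in> U"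
      unfolding eventually_at by blast
    \<comment> \<open>Only the tail of the path is known to lie in \<open>U\<close>; the comparison
      with \<open>F\<close> is made there.\<close>
    define s0 where "s0 = max (1 - \<delta>) 0"
    have s0: "0 \<le> s0" "s0 < 1" using \<delta>(1) by (auto simp: s0_def)
    have inU: "\<gamma> s \<in> U" if "s \<in> {s0<..1}" for s
      using that \<delta>(2)[of s] \<gamma>(2) U(2) by (cases "s = 1") (auto simp: s0_def dist_real_def)
    \<comment> \<open>The path truncated at \<open>s\<close> is admissible for
      \<open>\<gamma> s\<close>, and by uniqueness its end values are those of the full lift at
      \<open>s\<close>.\<close>
    have eq: "g_series d c (chi s) (chib s) = F (\<gamma> s) * E (\<gamma> s)" if s: "s \<in> {s0<..<1}" for s
    proof -
      have s': "0 < s" "s < 1" using s s0 by auto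
      have D: "\<gamma> s \<in> U \<inter> dom_D" using inU[of s] \<gamma>(3)[of s] s s' by auto
      then have "F (\<gamma> s) = g_series d c (chi s) (chib s) / E (\<gamma> s)"
        using Gval[OF _ admissible_scale[OF adm s']] full_lift_end_scale[OF adm lift s'] F(2) E(3) by auto
      then show ?thesis using E(2) D by simp
    qed
    have sub: "{s0<..1} \<subseteq> {0..1}" using s0 by auto
    \<comment> \<open>Both sides are continuous up to \<open>s = 1\<close> and agree before it,
      hence they agree at \<open>CL\<close>.\<close>
    have "continuous_on {s0<..1} (\<lambda>s. g_series d c (chi s) (chib s) - F (\<gamma> s) * E (\<gamma> s))"
      using inU \<gamma>(1) sub unfolding path_def
      by (intro continuous_on_diff continuous_on_mult continuous_on_subset[OF cont sub]
          continuous_on_compose2[OF contF] continuous_on_compose2[OF E(1)]) (auto intro: continuous_on_subset)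
    then have "((\<lambda>s. g_series d c (chi s) (chib s) - F (\<gamma> s) * E (\<gamma> s)) \<longlongrightarrow>
        g_series d c (chi 1) (chib 1) - F CL * E CL) (at 1 within {s0<..<1})"
      using s0(2) unfolding continuous_on_def \<gamma>(2)[symmetric]
      by (intro tendsto_within_subset[where S = "{s0<..1}" and T = "{s0<..<1}"]) auto
    moreover have "((\<lambda>s. g_series d c (chi s) (chib s) - F (\<gamma> s) * E (\<gamma> s)) \<longlongrightarrow> 0) (at 1 within {s0<..<1})"
      by (rule tendsto_eventually) (simp add: eventually_at_filter eq)
    moreover have "at 1 within {s0<..<1} \<noteq> bot"
      using s0(2) by (simp add: trivial_limit_within islimpt_greaterThanLessThan2)
    ultimately have "g_series d c (chi 1) (chib 1) - F CL * E CL = 0"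
      using tendsto_unique by blast
    then have "F CL = g_series d c (chi 1) (chib 1) / E CL"
      using E(2) U(2) by (simp add: field_simps)
    then show ?thesis
      using full_lift_end[OF adm lift] Im[of 1] E(4) by simp
  qed
  ultimately show ?thesis
    using value_F g_term_summable[OF conv] unfolding d_def[symmetric] by metis
qed

end
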